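(* Let $K=\mathbb{F}_q$, $n\ge 1$, let $K_0\subset\cdots\subset K_n$ be subfields of $K$ with $d_i=|K_i|$, and let $\mathcal X=[K_0\times K_1\times\cdots\times K_n]\subset\mathbb{P}^n(K)$ be the projective nested product of fields over $K_0,\dots,K_n$. For $i=1,\dots,n$ let $\mathcal X_i^*=K_{n+1-i}\times\cdots\times K_n\subset\mathbb{A}^i(K)$, and let $\mathcal X_0^*$ be a one-point set. Let $d\ge 1$ be an integer, with the restriction that if there exists an integer $r\geq 1$ such that $d_1=\cdots=d_r<d_{r+1}$ (with $r+1\le n$), then $d<d_{r+1}$. Then $$|\mathcal X|=\sum_{i=0}^n|\mathcal X_i^*|,\qquad \dim C_{\mathcal X}(d)=\sum_{i=0}^n\dim C_{\mathcal X_i^*}(d-1),\qquad \delta_{\mathcal X}(d)=\delta_{\mathcal X_n^*}(d-1).$$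
   Context: Projective code: $[K_0\times\cdots\times K_n]$ denotes the set of points $(a_0:\cdots:a_n)\in\mathbb{P}^n(K)$ with $a_i\in K_i$ for all $i$ (not all zero). Let $S_d$ be the $K$-vector space of homogeneous polynomials of degree $d$ in $K[X_0,\dots,X_n]$ together with $0$, and let $P_1,\dots,P_m$ be the points of $\mathcal X$, each written with its standard representative (first nonzero entry, from the left, equal to $1$). $C_{\mathcal X}(d)$ is the image of $S_d\to K^{|\mathcal X|}$, $f\mapsto(f(P_1),\dots,f(P_m))$. Affine cartesian code: for $i\ge 1$ and $e\ge 0$, $C_{\mathcal X_i^*}(e)$ is the image of the evaluation map from the $K$-vector space of polynomials in $i$ variables over $K$ of degree at most $e$ (together with $0$) to $K^{|\mathcal X_i^*|}$, sending $g$ to its vector of values at the points of $\mathcal X_i^*$. For $i=0$, $C_{\mathcal X_0^*}(e)=K$ (length $1$ and dimension $1$) for all $e\ge 0$. For each of these codes $C$, $\dim$ is the dimension over $K$ and $\delta$ is the minimum distance, i.e. the minimum number of nonzero entries of a nonzero codeword. In particular $\delta_{\mathcal X_n^*}(0)=d_1\cdots d_n$. *)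

theory Defs
  imports
    Complex_Main
    "HOL-Library.FuncSet"
    "HOL-Library.Function_Algebras"
    "HOL-Library.Poly_Mapping"
begin

definition is_subfield :: "'k::field set \<Rightarrow> bool" where
  "is_subfield L \<longleftrightarrow> 0 \<in> L \<and> 1 \<in> L \<and>
     (\<forall>x\<in>L. \<forall>y\<in>L. x + y \<in> L \<and> x * y \<in> L) \<and>
     (\<forall>x\<in>L. - x \<in> L \<and> inverse x \<in> L)"

text \<open>Polynomials over \<open>'k\<close> in variables \<open>X\<^sub>i\<close> indexed by natural numbers: finitely supported
  maps from monomials (finitely supported exponent functions) to coefficients.\<close>

type_synonym 'k mpoly = "(nat \<Rightarrow>\<^sub>0 nat) \<Rightarrow>\<^sub>0 'k"

definition mon_degree :: "(nat \<Rightarrow>\<^sub>0 nat) \<Rightarrow> nat" where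
  "mon_degree m = (\<Sum>i\<in>Poly_Mapping.keys m. Poly_Mapping.lookup m i)"

definition mpolys_in :: "nat set \<Rightarrow> 'k::field mpoly set" where
  "mpolys_in I = {f. \<forall>m\<in>Poly_Mapping.keys f. Poly_Mapping.keys m \<subseteq> I}"

text \<open>The zero polynomial belongs to each of the following two sets, since it has no monomials.\<close>

definition homogeneous_polys :: "nat set \<Rightarrow> nat \<Rightarrow> 'k::field mpoly set" where
  "homogeneous_polys I d = {f \<in> mpolys_in I. \<forall>m\<in>Poly_Mapping.keys f. mon_degree m = d}"

definition bounded_degree_polys :: "nat set \<Rightarrow> nat \<Rightarrow> 'k::field mpoly set" where
  "bounded_degree_polys I e = {f \<in> mpolys_in I. \<forall>m\<in>Poly_Mapping.keys f. mon_degree m \<le> e}"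

definition mpoly_eval :: "'k::field mpoly \<Rightarrow> (nat \<Rightarrow> 'k) \<Rightarrow> 'k" where
  "mpoly_eval f a =
     (\<Sum>m\<in>Poly_Mapping.keys f. Poly_Mapping.lookup f m *
        (\<Prod>i\<in>Poly_Mapping.keys m. a i ^ Poly_Mapping.lookup m i))"

text \<open>A word in \<open>K\<^bsup>|X|\<^esup>\<close>, for a finite set \<open>X\<close> of points, is a function on the type of points
  that vanishes outside \<open>X\<close>; its entries are indexed by the points themselves.\<close>

definition word_scale :: "'k::field \<Rightarrow> ('p \<Rightarrow> 'k) \<Rightarrow> 'p \<Rightarrow> 'k" where
  "word_scale c w = (\<lambda>p. c * w p)"

interpretation word_space: vector_space "word_scale :: 'k::field \<Rightarrow> ('p \<Rightarrow> 'k) \<Rightarrow> 'p \<Rightarrow> 'k"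
  by unfold_locales (auto simp: word_scale_def fun_eq_iff algebra_simps)

definition code_dim :: "('p \<Rightarrow> 'k::field) set \<Rightarrow> nat" where
  "code_dim C = word_space.dim C"

definition weight :: "('p \<Rightarrow> 'k::zero) \<Rightarrow> nat" where
  "weight w = card {p. w p \<noteq> 0}"

definition min_distance :: "('p \<Rightarrow> 'k::zero) set \<Rightarrow> nat" where
  "min_distance C = (LEAST t. \<exists>w\<in>C. w \<noteq> (\<lambda>_. 0) \<and> t = weight w)"

text \<open>Points of affine space with coordinates labelled by \<open>I\<close> are extensional functions on \<open>I\<close>.
  For \<open>I = {}\<close> there is exactly one point.\<close>

definition affine_code :: "nat set \<Rightarrow> (nat \<Rightarrow> 'k::field set) \<Rightarrow> nat \<Rightarrow> ((nat \<Rightarrow> 'k) \<Rightarrow> 'k) set" where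
  "affine_code I A e =
     (\<lambda>f a. if a \<in> Pi\<^sub>E I A then mpoly_eval f a else 0) ` bounded_degree_polys I e"

text \<open>\<open>tail_product n K i\<close> is \<open>K\<^bsub>n+1-i\<^esub> \<times> \<dots> \<times> K\<^sub>n\<close>, with the coordinates keeping the labels
  \<open>n+1-i, \<dots>, n\<close>.\<close>

definition tail_product :: "nat \<Rightarrow> (nat \<Rightarrow> 'k set) \<Rightarrow> nat \<Rightarrow> (nat \<Rightarrow> 'k) set" where
  "tail_product n K i = Pi\<^sub>E {n + 1 - i..n} K"

definition tail_code ::
    "nat \<Rightarrow> (nat \<Rightarrow> 'k::field set) \<Rightarrow> nat \<Rightarrow> nat \<Rightarrow> ((nat \<Rightarrow> 'k) \<Rightarrow> 'k) set" where
  "tail_code n K i e = affine_code {n + 1 - i..n} K e"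

lemma tail_product_0: "tail_product n K 0 = {\<lambda>_. undefined}"
  by (simp add: tail_product_def)

lemma tail_code_0: "tail_code n K 0 e = {w. \<forall>a. a \<notin> tail_product n K 0 \<longrightarrow> w a = 0}"
proof (intro equalityI subsetI)
  fix w :: "(nat \<Rightarrow> 'a) \<Rightarrow> 'a"
  assume "w \<in> {w. \<forall>a. a \<notin> tail_product n K 0 \<longrightarrow> w a = 0}"
  then have w: "w a = 0" if "a \<noteq> (\<lambda>_. undefined)" for a
    using that by (simp add: tail_product_0)
  define c where "c = w (\<lambda>_. undefined)"
  define f :: "'a mpoly" where "f = Poly_Mapping.single 0 c"
  have "f \<in> bounded_degree_polys {} e"
    by (auto simp: f_def bounded_degree_polys_def mpolys_in_def mon_degree_def)
  moreover have "mpoly_eval f a = c" for a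
    by (cases "c = 0") (auto simp: f_def mpoly_eval_def)
  then have "w = (\<lambda>a. if a \<in> Pi\<^sub>E {} K then mpoly_eval f a else 0)"
    using w by (intro ext) (simp add: c_def)
  ultimately show "w \<in> tail_code n K 0 e"
    by (auto simp: tail_code_def affine_code_def)
qed (auto simp: tail_code_def affine_code_def tail_product_def)

definition nonzero_vectors :: "nat \<Rightarrow> (nat \<Rightarrow> 'k::field) set" where
  "nonzero_vectors n = {a \<in> {..n} \<rightarrow>\<^sub>E UNIV. \<exists>i\<le>n. a i \<noteq> 0}"

definition proj_rel :: "nat \<Rightarrow> ((nat \<Rightarrow> 'k::field) \<times> (nat \<Rightarrow> 'k)) set" where
  "proj_rel n = {(a, b). a \<in> nonzero_vectors n \<and> b \<in> nonzero_vectors n \<and>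
     (\<exists>c. c \<noteq> 0 \<and> (\<forall>i\<le>n. b i = c * a i))}"

definition proj_space :: "nat \<Rightarrow> (nat \<Rightarrow> 'k::field) set set" where
  "proj_space n = nonzero_vectors n // proj_rel n"

definition std_rep :: "nat \<Rightarrow> (nat \<Rightarrow> 'k::field) set \<Rightarrow> nat \<Rightarrow> 'k" where
  "std_rep n P = (THE a. a \<in> P \<and> (\<exists>j\<le>n. a j = 1 \<and> (\<forall>i<j. a i = 0)))"

lemma std_rep_ex1:
  fixes P :: "(nat \<Rightarrow> 'k::field) set"
  assumes "P \<in> proj_space n"
  shows "\<exists>!a. a \<in> P \<and> (\<exists>j\<le>n. a j = 1 \<and> (\<forall>i<j. a i = 0))"
proof -
  obtain v where v: "v \<in> nonzero_vectors n" and P: "P = proj_rel n `` {v}"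
    using assms by (auto simp: proj_space_def quotient_def)
  have P_iff: "b \<in> P \<longleftrightarrow> b \<in> nonzero_vectors n \<and> (\<exists>c. c \<noteq> 0 \<and> (\<forall>i\<le>n. b i = c * v i))" for b
    using v by (auto simp: P proj_rel_def)
  define j where "j = (LEAST i. v i \<noteq> 0 \<and> i \<le> n)"
  have ex: "\<exists>i. v i \<noteq> 0 \<and> i \<le> n"
    using v by (auto simp: nonzero_vectors_def)
  have j: "v j \<noteq> 0" "j \<le> n"
    using LeastI_ex[OF ex] by (auto simp: j_def)
  have j0: "v i = 0" if "i < j" for i
    using not_less_Least[OF that[unfolded j_def]] that j(2) by auto
  define a where "a = (\<lambda>i\<in>{..n}. inverse (v j) * v i)"
  have a_ext: "a \<in> nonzero_vectors n"
    using j by (auto simp: nonzero_vectors_def a_def intro!: exI[of _ j])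
  have "a \<in> P"
    unfolding P_iff using a_ext j by (auto simp: a_def intro!: exI[of _ "inverse (v j)"])
  moreover have "a j = 1" "\<forall>i<j. a i = 0"
    using j j0 by (auto simp: a_def)
  moreover have "b = a" if b: "b \<in> P" "k \<le> n" "b k = 1" "\<forall>i<k. b i = 0" for b k
  proof -
    obtain c where c: "c \<noteq> 0" "\<forall>i\<le>n. b i = c * v i" and b_ext: "b \<in> nonzero_vectors n"
      using b(1) P_iff by blast
    have "v k \<noteq> 0"
      using b c by auto
    then have "\<not> k < j"
      using j0 by blast
    moreover have "\<not> j < k"
      using b c j by auto
    ultimately have "k = j" by simp
    then have "c * v j = 1"
      using b c by auto
    then have "c = inverse (v j)"
      using j by (simp add: field_simps)
    then have "b i = a i" for i
      using c b_ext by (auto simp: a_def nonzero_vectors_def PiE_def extensional_def)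
    then show ?thesis by blast
  qed
  ultimately show ?thesis
    using j(2) by (intro ex1I[of _ a]) blast+
qed

definition proj_product :: "nat \<Rightarrow> (nat \<Rightarrow> 'k::field set) \<Rightarrow> (nat \<Rightarrow> 'k) set set" where
  "proj_product n K = {P \<in> proj_space n. \<exists>a\<in>P. \<forall>i\<le>n. a i \<in> K i}"

definition proj_code ::
    "nat \<Rightarrow> (nat \<Rightarrow> 'k::field set) \<Rightarrow> nat \<Rightarrow> ((nat \<Rightarrow> 'k) set \<Rightarrow> 'k) set" where
  "proj_code n K d =
     (\<lambda>f P. if P \<in> proj_product n K then mpoly_eval f (std_rep n P) else 0)
       ` homogeneous_polys {..n} d"

end

(* Dimension. Let S_j be the set of standard representatives whose leading 1 is at index >= j.
Restricting forms of degree d from S_j to S_(j+1) has as kernel the values of forms vanishing on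
S_(j+1). By homogeneity and nestedness such a form vanishes wherever x_0 = ... = x_j = 0, so on the
affine chart with leading index j it is a polynomial of degree <= d - 1 in x_(j+1), ..., x_n; conversely
every such polynomial homogenizes to a form divisible by x_j. Counting codewords turns the resulting
exact sequences into a sum of dimensions.

Minimum distance, lower bound. K_0 plays no role, so let K_0 = K_1 = ... = K_r have q elements with r
maximal, and count vectors of K_0 x ... x K_n instead of points.

If the form f vanishes on x_0 = ... = x_r = 0, take k minimal such that, after a linear change of
x_0, ..., x_r over K_0, f vanishes on x_0 = ... = x_k = 0. Each slice x_i = c_i x_0 (1 <= i <= k) then
contains a nonzero of f, and on its chart x_0 = 1 f has degree <= d - 1. Summing the affine bounds
of the slices is enough, because delta(K_1 x ... x K_n) <= q^k delta(K_(k+1) x ... x K_n).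

Otherwise f is nonzero at some z with z_0 = ... = z_r = 0. On each line v + t z with t in K_(r+1),
f is a polynomial in t with leading term f(z) t^d, so it has at least D - d nonzeros,
where D = |K_(r+1)| > d. The resulting bound is compared with the weight of explicit products of linear
factors in the two variables x_1 and x_(r+1). *)

theory Submission imports Defs "HOL-Computational_Algebra.Polynomial" begin

section \<open>Polynomial functions\<close>

text \<open>A monomial is encoded as the list of its variables with repetition: its degree is the
  length, multiplication is concatenation, and arguments about monomials become list
  inductions.\<close>

definition mono_fun :: "nat list \<Rightarrow> (nat \<Rightarrow> 'k::field) \<Rightarrow> 'k" where
  "mono_fun xs = (\<lambda>a. prod_list (map a xs))"

text \<open>\<open>D\<close> is the set of admissible degrees of monomials: \<open>{d}\<close> gives
  the forms of degree \<open>d\<close>, \<open>{..e}\<close> the polynomials of degree at most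
  \<open>e\<close>. The elements are functions rather than formal polynomials because codewords
  depend only on values.\<close>

definition poly_funs :: "nat set \<Rightarrow> nat set \<Rightarrow> ((nat \<Rightarrow> 'k::field) \<Rightarrow> 'k) set" where
  "poly_funs I D = word_space.span (mono_fun ` {xs. set xs \<subseteq> I \<and> length xs \<in> D})"

section \<open>Formal polynomials and the functions they define\<close>

lemma mpoly_eval_superset:
  assumes "finite A" "Poly_Mapping.keys f \<subseteq> A"
  shows "mpoly_eval f a = (\<Sum>m\<in>A. Poly_Mapping.lookup f m *
    (\<Prod>i\<in>Poly_Mapping.keys m. a i ^ Poly_Mapping.lookup m i))"
  unfolding mpoly_eval_def using assms
  by (intro sum.mono_neutral_left) (auto simp: in_keys_iff)

lemma mpoly_eval_add: "mpoly_eval (f + g) = mpoly_eval f + mpoly_eval g"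
proof
  fix a :: "nat \<Rightarrow> 'a"
  let ?A = "Poly_Mapping.keys f \<union> Poly_Mapping.keys g"
  have "mpoly_eval (f + g) a = (\<Sum>m\<in>?A. Poly_Mapping.lookup (f + g) m *
    (\<Prod>i\<in>Poly_Mapping.keys m. a i ^ Poly_Mapping.lookup m i))"
    by (intro mpoly_eval_superset) (auto simp: keys_add)
  also have "\<dots> = mpoly_eval f a + mpoly_eval g a"
    by (subst (1 2) mpoly_eval_superset[of ?A])
      (auto simp: lookup_add algebra_simps sum.distrib)
  finally show "mpoly_eval (f + g) a = (mpoly_eval f + mpoly_eval g) a" by simp
qed

lemma mpoly_eval_single:
  "mpoly_eval (Poly_Mapping.single m c) =
     word_scale c (\<lambda>a. \<Prod>i\<in>Poly_Mapping.keys m. a i ^ Poly_Mapping.lookup m i)"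
  by (cases "c = 0") (auto simp: mpoly_eval_def word_scale_def)

lemma ex_mono_fun:
  fixes e :: "nat \<Rightarrow> nat"
  assumes "finite A"
  shows "\<exists>xs. set xs \<subseteq> A \<and> length xs = (\<Sum>i\<in>A. e i) \<and>
    mono_fun xs = (\<lambda>a :: nat \<Rightarrow> 'k::field. \<Prod>i\<in>A. a i ^ e i)"
  using assms
proof (induction A)
  case empty
  show ?case by (auto simp: mono_fun_def)
next
  case (insert x A)
  then obtain xs where xs: "set xs \<subseteq> A" "length xs = (\<Sum>i\<in>A. e i)"
    "mono_fun xs = (\<lambda>a :: nat \<Rightarrow> 'k. \<Prod>i\<in>A. a i ^ e i)"
    by blast
  show ?case
    using xs insert.hyps
    by (intro exI[of _ "replicate (e x) x @ xs"]) (auto simp: mono_fun_def fun_eq_iff map_replicate_const prod_list_replicate)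
qed

lemma prod_power_count_list:
  fixes a :: "nat \<Rightarrow> 'k::field"
  assumes "finite A" "set xs \<subseteq> A"
  shows "(\<Prod>i\<in>A. a i ^ count_list xs i) = mono_fun xs a"
  using assms(2)
proof (induction xs)
  case Nil
  show ?case by (simp add: mono_fun_def)
next
  case (Cons x xs)
  have "(\<Prod>i\<in>A. a i ^ count_list (x # xs) i) =
      (\<Prod>i\<in>A. (if i = x then a i else 1) * a i ^ count_list xs i)"
    by (intro prod.cong) auto
  also have "\<dots> = a x * mono_fun xs a"
    using Cons assms(1) by (subst prod.distrib) (auto simp: prod.delta)
  finally show ?case by (simp add: mono_fun_def)
qed

lemma ex_monomial:
  "\<exists>m. Poly_Mapping.keys m = set xs \<and> mon_degree m = length xs \<and>
     (\<lambda>a :: nat \<Rightarrow> 'k::field. \<Prod>i\<in>Poly_Mapping.keys m. a i ^ Poly_Mapping.lookup m i) = mono_fun xs"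
proof -
  define m where "m = Abs_poly_mapping (count_list xs)"
  have set: "{i. count_list xs i \<noteq> 0} = set xs"
    by (auto simp: count_list_0_iff)
  have lookup: "Poly_Mapping.lookup m = count_list xs"
    unfolding m_def by (subst Abs_poly_mapping_inverse) (simp_all add: set[unfolded neq0_conv])
  have keys: "Poly_Mapping.keys m = set xs"
    by (auto simp: in_keys_iff lookup count_list_0_iff)
  show ?thesis
    using sum_count_set[of xs "set xs"]
    by (intro exI[of _ m]) (auto simp: keys lookup mon_degree_def prod_power_count_list fun_eq_iff)
qed

lemma sum_fun_apply: "sum F A x = (\<Sum>m\<in>A. F m x)"
  for F :: "'i \<Rightarrow> 'p \<Rightarrow> 'k::comm_monoid_add"
  by (induction A rule: infinite_finite_induct) simp_all

text \<open>This is the bridge from formal polynomials to \<open>poly_funs\<close>, for any set of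
  degrees. One inclusion expands a polynomial into its monomials; the other adds one monomial at a
  time by induction over the span.\<close>

lemma mpoly_eval_image:
  "mpoly_eval ` {f \<in> mpolys_in I. \<forall>m\<in>Poly_Mapping.keys f. mon_degree m \<in> D} =
     (poly_funs I D :: ((nat \<Rightarrow> 'k::field) \<Rightarrow> 'k) set)" (is "mpoly_eval ` ?P = _")
proof (intro equalityI subsetI)
  fix w :: "(nat \<Rightarrow> 'k) \<Rightarrow> 'k"
  assume "w \<in> mpoly_eval ` ?P"
  then obtain f where f: "f \<in> ?P" and w: "w = mpoly_eval f" by blast
  have "w = (\<Sum>m\<in>Poly_Mapping.keys f. word_scale (Poly_Mapping.lookup f m)
     (\<lambda>a. \<Prod>i\<in>Poly_Mapping.keys m. a i ^ Poly_Mapping.lookup m i))"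
    by (intro ext) (simp only: w mpoly_eval_def sum_fun_apply word_scale_def)
  also have "\<dots> \<in> poly_funs I D"
    unfolding poly_funs_def
  proof (intro word_space.span_sum word_space.span_scale word_space.span_base)
    fix m assume m: "m \<in> Poly_Mapping.keys f"
    obtain xs where xs: "set xs \<subseteq> Poly_Mapping.keys m" "length xs = mon_degree m"
      "mono_fun xs = (\<lambda>a :: nat \<Rightarrow> 'k. \<Prod>i\<in>Poly_Mapping.keys m. a i ^ Poly_Mapping.lookup m i)"
      using ex_mono_fun[of "Poly_Mapping.keys m"] unfolding mon_degree_def by (metis finite_keys)
    have "xs \<in> {xs. set xs \<subseteq> I \<and> length xs \<in> D}"
      using f m xs(1,2) by (auto simp: mpolys_in_def)
    then show "(\<lambda>a :: nat \<Rightarrow> 'k. \<Prod>i\<in>Poly_Mapping.keys m. a i ^ Poly_Mapping.lookup m i)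
        \<in> mono_fun ` {xs. set xs \<subseteq> I \<and> length xs \<in> D}"
      unfolding xs(3)[symmetric] by (rule imageI)
  qed
  finally show "w \<in> poly_funs I D" .
next
  fix w :: "(nat \<Rightarrow> 'k) \<Rightarrow> 'k"
  assume "w \<in> poly_funs I D"
  then show "w \<in> mpoly_eval ` ?P"
    unfolding poly_funs_def
  proof (induction rule: word_space.span_induct_alt)
    case base
    have "mpoly_eval 0 = (0 :: (nat \<Rightarrow> 'k) \<Rightarrow> 'k)"
      by (auto simp: mpoly_eval_def)
    then show ?case
      by (auto simp: mpolys_in_def intro!: image_eqI[of _ _ 0])
  next
    case (step c x y)
    obtain f where f: "f \<in> ?P" "y = mpoly_eval f"
      using step by blast
    obtain xs where xs: "x = mono_fun xs" "set xs \<subseteq> I" "length xs \<in> D"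
      using step by blast
    obtain m where m: "Poly_Mapping.keys m = set xs" "mon_degree m = length xs"
      "(\<lambda>a :: nat \<Rightarrow> 'k. \<Prod>i\<in>Poly_Mapping.keys m. a i ^ Poly_Mapping.lookup m i) = mono_fun xs"
      using ex_monomial[of xs] by blast
    have "mpoly_eval (Poly_Mapping.single m c + f) = word_scale c x + y"
      by (simp only: mpoly_eval_add mpoly_eval_single f(2) m(3) xs(1))
    moreover have "Poly_Mapping.single m c + f \<in> ?P"
    proof -
      have "Poly_Mapping.keys k \<subseteq> I \<and> mon_degree k \<in> D"
        if "k \<in> Poly_Mapping.keys (Poly_Mapping.single m c + f)" for k
      proof -
        have "k = m \<or> k \<in> Poly_Mapping.keys f"
          using keys_add[of "Poly_Mapping.single m c" f] that by (auto split: if_splits)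
        then show ?thesis
          using f(1) m(1,2) xs(2,3) unfolding mpolys_in_def by auto
      qed
      then show ?thesis
        unfolding mpolys_in_def by blast
    qed
    ultimately show ?case
      by (rule image_eqI[OF sym])
  qed
qed

lemma mpoly_eval_homogeneous: "mpoly_eval ` homogeneous_polys I d = poly_funs I {d}"
  unfolding homogeneous_polys_def by (subst mpoly_eval_image[symmetric]) simp

lemma mpoly_eval_bounded: "mpoly_eval ` bounded_degree_polys I e = poly_funs I {..e}"
  unfolding bounded_degree_polys_def by (subst mpoly_eval_image[symmetric]) simp

section \<open>Closure properties and induction for polynomial functions\<close>

lemma poly_funs_mono: "I \<subseteq> J \<Longrightarrow> D \<subseteq> E \<Longrightarrow> poly_funs I D \<subseteq> poly_funs J E"
  unfolding poly_funs_def by (intro word_space.span_mono) auto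

lemma mono_fun_in: "set xs \<subseteq> I \<Longrightarrow> length xs \<in> D \<Longrightarrow> mono_fun xs \<in> poly_funs I D"
  unfolding poly_funs_def by (intro word_space.span_base) auto

lemma poly_funs_subspace: "word_space.subspace (poly_funs I D)"
  unfolding poly_funs_def by simp

lemma poly_funs_0: "(\<lambda>_. 0) \<in> poly_funs I D"
  using word_space.subspace_0[OF poly_funs_subspace, of I D] by (simp add: zero_fun_def)

lemma poly_funs_add: "f \<in> poly_funs I D \<Longrightarrow> g \<in> poly_funs I D \<Longrightarrow> (\<lambda>a. f a + g a) \<in> poly_funs I D"
  using word_space.subspace_add[OF poly_funs_subspace, of f I D g] by (simp add: plus_fun_def)

lemma poly_funs_scale: "f \<in> poly_funs I D \<Longrightarrow> (\<lambda>a. c * f a) \<in> poly_funs I D"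
  using word_space.subspace_scale[OF poly_funs_subspace, of f I D c] by (simp add: word_scale_def)

lemma poly_funs_diff: "f \<in> poly_funs I D \<Longrightarrow> g \<in> poly_funs I D \<Longrightarrow> (\<lambda>a. f a - g a) \<in> poly_funs I D"
  using poly_funs_add[of f I D "\<lambda>a. (-1) * g a"] poly_funs_scale[of g I D "-1"] by simp

lemma poly_funs_induct [consumes 1, case_names zero step]:
  assumes "f \<in> poly_funs I D"
    and "P (\<lambda>_. 0)"
    and "\<And>c xs g. set xs \<subseteq> I \<Longrightarrow> length xs \<in> D \<Longrightarrow> P g \<Longrightarrow> P (\<lambda>a. c * mono_fun xs a + g a)"
  shows "P f"
  using assms(1) unfolding poly_funs_def
proof (induction rule: word_space.span_induct_alt)
  case base
  then show ?case using assms(2) by (simp add: zero_fun_def)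
next
  case (step c x y)
  then show ?case using assms(3) by (force simp: plus_fun_def word_scale_def)
qed

lemma mono_fun_Nil: "mono_fun [] a = 1"
  by (simp add: mono_fun_def)

lemma mono_fun_append: "mono_fun (xs @ ys) a = mono_fun xs a * mono_fun ys a"
  by (simp add: mono_fun_def)

lemma mono_fun_Cons: "mono_fun (x # xs) a = a x * mono_fun xs a"
  by (simp add: mono_fun_def)

lemma poly_funs_const: "0 \<in> D \<Longrightarrow> (\<lambda>_. c) \<in> poly_funs I D"
  using poly_funs_scale[OF mono_fun_in[of "[]" I D], of c] by (simp add: mono_fun_def)

lemma poly_funs_var: "i \<in> I \<Longrightarrow> 1 \<in> D \<Longrightarrow> (\<lambda>a. a i) \<in> poly_funs I D"
  using mono_fun_in[of "[i]" I D] by (simp add: mono_fun_def)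

lemma poly_funs_mult:
  assumes "f \<in> poly_funs I D" "g \<in> poly_funs I E" "\<And>a b. a \<in> D \<Longrightarrow> b \<in> E \<Longrightarrow> a + b \<in> F"
  shows "(\<lambda>a. f a * g a) \<in> poly_funs I F"
  using assms(1)
proof (induction rule: poly_funs_induct)
  case zero
  then show ?case by (simp add: poly_funs_0)
next
  case (step c xs h)
  have "(\<lambda>a. mono_fun xs a * g a) \<in> poly_funs I F"
    using assms(2)
  proof (induction rule: poly_funs_induct)
    case zero
    then show ?case by (simp add: poly_funs_0)
  next
    case (step c' ys h)
    have "(\<lambda>a. c' * mono_fun (xs @ ys) a + mono_fun xs a * h a) \<in> poly_funs I F"
      using step assms(3) \<open>set xs \<subseteq> I\<close> \<open>length xs \<in> D\<close>
      by (intro poly_funs_add poly_funs_scale mono_fun_in) auto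
    then show ?case by (simp add: mono_fun_append algebra_simps)
  qed
  from poly_funs_add[OF poly_funs_scale[OF this, of c] step(3)]
  show ?case by (simp add: algebra_simps)
qed

text \<open>A linear substitution turns every monomial of degree \<open>d\<close> into a product of
  \<open>d\<close> linear forms. It serves the changes of coordinates in the lower bound for the
  minimum distance.\<close>

lemma poly_funs_subst:
  assumes "f \<in> poly_funs I {d}" "\<And>i. i \<in> I \<Longrightarrow> (\<lambda>y. T y i) \<in> poly_funs J {1}"
  shows "(\<lambda>y. f (T y)) \<in> poly_funs J {d}"
  using assms(1)
proof (induction rule: poly_funs_induct)
  case zero
  then show ?case by (simp add: poly_funs_0)
next
  case (step c xs g)
  have "(\<lambda>y. mono_fun xs (T y)) \<in> poly_funs J {length xs}"
    using \<open>set xs \<subseteq> I\<close>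
  proof (induction xs)
    case Nil
    then show ?case by (simp add: mono_fun_def poly_funs_const)
  next
    case (Cons x xs)
    then have "(\<lambda>y. T y x * mono_fun xs (T y)) \<in> poly_funs J {length (x # xs)}"
      using assms(2)[of x] by (intro poly_funs_mult[where D = "{1}" and E = "{length xs}"]) auto
    then show ?case by (simp add: mono_fun_Cons)
  qed
  then show ?case
    using step by (intro poly_funs_add poly_funs_scale) auto
qed

section \<open>Homogeneity, specialization to charts and lines, homogenization\<close>

lemma poly_funs_homogeneous:
  assumes "f \<in> poly_funs I {d}" "\<And>i. i \<in> I \<Longrightarrow> y i = c * x i"
  shows "f y = c ^ d * f x"
  using assms(1)
proof (induction rule: poly_funs_induct)
  case (step c' xs g)
  have "mono_fun xs y = c ^ length xs * mono_fun xs x"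
    using step(1) assms(2) by (induction xs) (auto simp: mono_fun_def)
  then show ?case using step by (simp add: algebra_simps)
qed simp

lemma poly_funs_cong:
  assumes "f \<in> poly_funs I D" "\<And>i. i \<in> I \<Longrightarrow> y i = x i"
  shows "f y = f x"
  using assms(1)
proof (induction rule: poly_funs_induct)
  case (step c' xs g)
  have "mono_fun xs y = mono_fun xs x"
    using step(1) assms(2) by (induction xs) (auto simp: mono_fun_def)
  then show ?case using step by simp
qed simp

text \<open>Monomials avoiding \<open>J\<close> cancel in the difference; every other monomial is 0
  in the second term and loses at least one variable in the first, so its degree drops below
  \<open>d\<close>. This is the origin of \<open>d - 1\<close> in the formulas for dimension and
  distance.\<close>

lemma poly_funs_partial_eval:
  fixes f :: "(nat \<Rightarrow> 'k::field) \<Rightarrow> 'k"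
  assumes "f \<in> poly_funs I {d}" "d \<ge> 1"
  shows "(\<lambda>b. f (\<lambda>i. if i \<in> J then c i else b i) - f (\<lambda>i. if i \<in> J then 0 else b i))
    \<in> poly_funs (I - J) {..d - 1}"
  using assms(1)
proof (induction rule: poly_funs_induct)
  case zero
  then show ?case by (simp add: poly_funs_0)
next
  case (step c' xs g)
  have split: "mono_fun xs (\<lambda>i. if i \<in> J then c i else b i) =
      mono_fun (filter (\<lambda>i. i \<in> J) xs) c * mono_fun (filter (\<lambda>i. i \<notin> J) xs) b" for b c :: "nat \<Rightarrow> 'k"
    by (induction xs) (auto simp: mono_fun_def)
  have "(\<lambda>b. mono_fun xs (\<lambda>i. if i \<in> J then c i else b i) - mono_fun xs (\<lambda>i. if i \<in> J then 0 else b i))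
      \<in> poly_funs (I - J) {..d - 1}"
  proof (cases "filter (\<lambda>i. i \<in> J) xs = []")
    case True
    then show ?thesis by (simp add: split mono_fun_Nil poly_funs_0)
  next
    case False
    then have "mono_fun (filter (\<lambda>i. i \<in> J) xs) (\<lambda>_. 0 :: 'k) = 0"
      by (auto simp: mono_fun_def prod_list_zero_iff filter_empty_conv)
    moreover have "mono_fun (filter (\<lambda>i. i \<notin> J) xs) \<in> poly_funs (I - J) {..d - 1}"
      using False step(1,2) sum_length_filter_compl[of "\<lambda>i. i \<in> J" xs]
      by (intro mono_fun_in) (auto simp: Suc_le_eq simp flip: length_greater_0_conv)
    ultimately show ?thesis
      using poly_funs_scale[of "mono_fun (filter (\<lambda>i. i \<notin> J) xs)" "I - J" "{..d - 1}"
          "mono_fun (filter (\<lambda>i. i \<in> J) xs) c"]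
      by (simp add: split split[of "\<lambda>_. 0"])
  qed
  from poly_funs_add[OF poly_funs_scale[OF this, of c'] step(3)]
  show ?case by (simp add: algebra_simps)
qed

text \<open>Each variable becomes the linear polynomial \<open>[:x i, z i:]\<close>, and the top
  coefficients \<open>z i\<close> multiply to the monomial at \<open>z\<close>. The coefficient at
  \<open>d\<close>, rather than the leading one, is recorded because it is additive and remains
  meaningful when \<open>f z = 0\<close>.\<close>

lemma poly_funs_on_line:
  fixes f :: "(nat \<Rightarrow> 'k::field) \<Rightarrow> 'k"
  assumes "f \<in> poly_funs I {d}"
  shows "\<exists>p. degree p \<le> d \<and> coeff p d = f z \<and> (\<forall>t. poly p t = f (\<lambda>i. x i + t * z i))"
  using assms
proof (induction rule: poly_funs_induct)
  case zero
  show ?case by (intro exI[of _ 0]) auto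
next
  case (step c xs g)
  have "\<exists>p. degree p \<le> length xs \<and> coeff p (length xs) = mono_fun xs z \<and>
      (\<forall>t. poly p t = mono_fun xs (\<lambda>i. x i + t * z i))"
  proof (induction xs)
    case Nil
    show ?case by (intro exI[of _ 1]) (auto simp: mono_fun_def)
  next
    case (Cons i xs)
    then obtain p where p: "degree p \<le> length xs" "coeff p (length xs) = mono_fun xs z"
      "\<forall>t. poly p t = mono_fun xs (\<lambda>i. x i + t * z i)"
      by blast
    have "coeff p (Suc (length xs)) = 0"
      using p(1) by (intro coeff_eq_0) auto
    then show ?case
      using p degree_mult_le[of "[:x i, z i:]" p]
      by (intro exI[of _ "[:x i, z i:] * p"]) (auto simp: mono_fun_Cons algebra_simps intro: order_trans)
  qed
  then obtain p where p: "degree p \<le> d" "coeff p d = mono_fun xs z"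
      "\<forall>t. poly p t = mono_fun xs (\<lambda>i. x i + t * z i)"
    using step(2) by auto
  obtain p' where p': "degree p' \<le> d" "coeff p' d = g z"
      "\<forall>t. poly p' t = g (\<lambda>i. x i + t * z i)"
    using step(3) by auto
  show ?case
    using p p' by (intro exI[of _ "smult c p + p'"]) (auto intro!: degree_add_le)
qed

text \<open>Each monomial is padded with copies of the variable \<open>j\<close> up to degree
  \<open>d\<close>. As its degree is at most \<open>d - 1\<close>, at least one copy is added, hence
  the vanishing where \<open>x j = 0\<close>.\<close>

lemma ex_homogenization:
  fixes g :: "(nat \<Rightarrow> 'k::field) \<Rightarrow> 'k"
  assumes "g \<in> poly_funs I {..d - 1}" "d \<ge> 1" "j \<in> J" "I \<subseteq> J"
  shows "\<exists>f \<in> poly_funs J {d}. \<forall>x. (x j = 0 \<longrightarrow> f x = 0) \<and> (x j = 1 \<longrightarrow> f x = g x)"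
  using assms(1)
proof (induction rule: poly_funs_induct)
  case zero
  show ?case using poly_funs_0 by force
next
  case (step c xs g)
  then obtain f where f: "f \<in> poly_funs J {d}"
    "\<And>x. (x j = 0 \<longrightarrow> f x = 0) \<and> (x j = 1 \<longrightarrow> f x = g x)"
    by blast
  let ?ys = "replicate (d - length xs) j @ xs"
  have "(\<lambda>x. c * mono_fun ?ys x + f x) \<in> poly_funs J {d}"
    using step(1,2) assms f by (intro poly_funs_add poly_funs_scale mono_fun_in) auto
  moreover have "mono_fun ?ys x = x j ^ (d - length xs) * mono_fun xs x" for x :: "nat \<Rightarrow> 'k"
    by (simp add: mono_fun_def map_replicate_const prod_list_replicate)
  moreover have "d - length xs > 0"
    using step(2) assms by auto
  ultimately show ?case
    using f(2) by (intro bexI[of _ "\<lambda>x. c * mono_fun ?ys x + f x"]) auto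
qed

section \<open>Number of points and dimension\<close>

definition restr :: "'p set \<Rightarrow> ('p \<Rightarrow> 'k::zero) \<Rightarrow> 'p \<Rightarrow> 'k" where
  "restr S f = (\<lambda>p. if p \<in> S then f p else 0)"

lemma subspace_restr_image:
  assumes "word_space.subspace V"
  shows "word_space.subspace (restr S ` V)"
proof (rule word_space.subspaceI)
  have "restr S 0 = 0" by (auto simp: restr_def)
  then show "0 \<in> restr S ` V"
    using word_space.subspace_0[OF assms] by force
next
  fix x y assume "x \<in> restr S ` V" "y \<in> restr S ` V"
  then obtain f g where "f \<in> V" "g \<in> V" "x = restr S f" "y = restr S g" by blast
  moreover have "restr S f + restr S g = restr S (f + g)"
    by (auto simp: restr_def)
  ultimately show "x + y \<in> restr S ` V"
    using word_space.subspace_add[OF assms] by auto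
next
  fix c x assume "x \<in> restr S ` V"
  then obtain f where "f \<in> V" "x = restr S f" by blast
  moreover have "word_scale c (restr S f) = restr S (word_scale c f)"
    by (auto simp: restr_def word_scale_def)
  ultimately show "word_scale c x \<in> restr S ` V"
    using word_space.subspace_scale[OF assms] by auto
qed

lemma finite_restr_image:
  fixes V :: "('p \<Rightarrow> 'k::{zero,finite}) set"
  assumes "finite S"
  shows "finite (restr S ` V)"
proof (rule finite_subset)
  show "restr S ` V \<subseteq> {w. \<forall>p. (p \<in> S \<longrightarrow> w p \<in> UNIV) \<and> (p \<notin> S \<longrightarrow> w p = 0)}"
    by (auto simp: restr_def)
  show "finite {w :: 'p \<Rightarrow> 'k. \<forall>p. (p \<in> S \<longrightarrow> w p \<in> UNIV) \<and> (p \<notin> S \<longrightarrow> w p = 0)}"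
    by (rule finite_set_of_finite_funs[OF assms finite])
qed

text \<open>Coordinates with respect to a basis identify \<open>C\<close> with the functions from
  that basis to the field. Sums of dimensions can thus be read off from products of
  cardinalities.\<close>

lemma card_subspace:
  fixes C :: "('p \<Rightarrow> 'k::{field,finite}) set"
  assumes "word_space.subspace C" "finite C"
  shows "card C = card (UNIV :: 'k set) ^ code_dim C"
proof -
  obtain B where B: "B \<subseteq> C" "word_space.independent B" "C \<subseteq> word_space.span B"
    "card B = word_space.dim C"
    using word_space.basis_exists[of C] by blast
  have fin: "finite B"
    using B(1) assms(2) by (rule finite_subset)
  have C: "C = word_space.span B"
    using B(1,3) assms(1) by (simp add: word_space.span_minimal subset_antisym)
  define \<phi> where "\<phi> u = (\<Sum>b\<in>B. word_scale (u b) b)" for u :: "('p \<Rightarrow> 'k) \<Rightarrow> 'k"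
  have "inj_on \<phi> (B \<rightarrow>\<^sub>E UNIV)"
  proof (rule inj_onI)
    fix u v assume uv: "u \<in> B \<rightarrow>\<^sub>E UNIV" "v \<in> B \<rightarrow>\<^sub>E UNIV" and eq: "\<phi> u = \<phi> v"
    have "(\<Sum>b\<in>B. word_scale (u b - v b) b) = 0"
      using eq by (simp add: \<phi>_def word_space.scale_left_diff_distrib sum_subtractf)
    then have "u b - v b = 0" if "b \<in> B" for b
      using word_space.independentD[OF B(2) fin subset_refl _ that, of "\<lambda>b. u b - v b"] by simp
    then show "u = v"
      using uv by (intro PiE_ext[of u B "\<lambda>_. UNIV"]) auto
  qed
  moreover have "\<phi> ` (B \<rightarrow>\<^sub>E UNIV) = C"
  proof -
    have "\<phi> u = \<phi> (restrict u B)" for u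
      unfolding \<phi>_def by (intro sum.cong) auto
    then have "range \<phi> = \<phi> ` (B \<rightarrow>\<^sub>E UNIV)"
      by (auto intro!: image_eqI[of _ _ "restrict _ B"])
    then show ?thesis
      by (simp add: C word_space.span_finite[OF fin] \<phi>_def)
  qed
  ultimately have "card C = card (B \<rightarrow>\<^sub>E (UNIV :: 'k set))"
    using card_image by metis
  also have "\<dots> = card (UNIV :: 'k set) ^ card B"
    by (rule card_funcsetE[OF fin])
  finally show ?thesis
    by (simp add: B(4) code_dim_def)
qed

text \<open>Every nonempty fibre of an additive map is a translate of its kernel.\<close>

lemma card_eq_card_image_times_kernel:
  fixes V :: "('p \<Rightarrow> 'k::{field,finite}) set"
  assumes "word_space.subspace V" "finite V"
    and add: "\<And>v w. \<rho> (v + w) = \<rho> v + (\<rho> w :: 'q \<Rightarrow> 'k)"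
  shows "card V = card (\<rho> ` V) * card {v \<in> V. \<rho> v = 0}"
proof -
  have diff: "\<rho> (v - w) = \<rho> v - \<rho> w" for v w
    using add[of "v - w" w] by simp
  have fibre: "card {v \<in> V. \<rho> v = y} = card {v \<in> V. \<rho> v = 0}" if "y \<in> \<rho> ` V" for y
  proof -
    obtain v0 where v0: "v0 \<in> V" "y = \<rho> v0"
      using \<open>y \<in> \<rho> ` V\<close> by blast
    have "bij_betw (\<lambda>v. v - v0) {v \<in> V. \<rho> v = y} {v \<in> V. \<rho> v = 0}"
      by (rule bij_betw_byWitness[where f' = "\<lambda>v. v + v0"])
        (use v0 assms(1) in \<open>auto simp: diff add word_space.subspace_diff word_space.subspace_add\<close>)
    then show ?thesis by (rule bij_betw_same_card)
  qed
  have "card V = (\<Sum>y\<in>\<rho> ` V. \<Sum>v | v \<in> V \<and> \<rho> v = y. 1)"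
    using sum.image_gen[OF assms(2), of "\<lambda>_. 1 :: nat" \<rho>] by simp
  also have "\<dots> = (\<Sum>y\<in>\<rho> ` V. card {v \<in> V. \<rho> v = 0})"
    using fibre by (intro sum.cong) auto
  finally show ?thesis by simp
qed

lemma affine_code_eq: "affine_code I A e = restr (Pi\<^sub>E I A) ` poly_funs I {..e}"
  unfolding affine_code_def mpoly_eval_bounded[symmetric] image_image restr_def ..

section \<open>Projective points and their standard representatives\<close>

lemma equiv_proj_rel: "equiv (nonzero_vectors n) (proj_rel n :: ((nat \<Rightarrow> 'k::field) \<times> _) set)"
proof (rule equivI)
  show "refl_on (nonzero_vectors n) (proj_rel n :: ((nat \<Rightarrow> 'k) \<times> _) set)"
    by (auto simp: refl_on_def proj_rel_def intro!: exI[of _ 1])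
  show "(proj_rel n :: ((nat \<Rightarrow> 'k) \<times> _) set) \<subseteq> nonzero_vectors n \<times> nonzero_vectors n"
    by (auto simp: proj_rel_def)
  show "sym (proj_rel n :: ((nat \<Rightarrow> 'k) \<times> _) set)"
  proof (rule symI)
    fix a b :: "nat \<Rightarrow> 'k"
    assume "(a, b) \<in> proj_rel n"
    then obtain c where "a \<in> nonzero_vectors n" "b \<in> nonzero_vectors n" "c \<noteq> 0" "\<forall>i\<le>n. b i = c * a i"
      by (auto simp: proj_rel_def)
    then show "(b, a) \<in> proj_rel n"
      by (auto simp: proj_rel_def intro!: exI[of _ "inverse c"])
  qed
  show "trans (proj_rel n :: ((nat \<Rightarrow> 'k) \<times> _) set)"
  proof (rule transI)
    fix a b b' :: "nat \<Rightarrow> 'k"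
    assume "(a, b) \<in> proj_rel n" "(b, b') \<in> proj_rel n"
    then obtain c c' where "a \<in> nonzero_vectors n" "b' \<in> nonzero_vectors n" "c \<noteq> 0" "c' \<noteq> 0"
      "\<forall>i\<le>n. b i = c * a i" "\<forall>i\<le>n. b' i = c' * b i"
      by (auto simp: proj_rel_def)
    then show "(a, b') \<in> proj_rel n"
      by (auto simp: proj_rel_def intro!: exI[of _ "c' * c"])
  qed
qed

lemma std_rep:
  assumes "P \<in> proj_space n"
  shows std_rep_in: "std_rep n P \<in> P"
    and std_rep_leading: "\<exists>j\<le>n. std_rep n P j = 1 \<and> (\<forall>i<j. std_rep n P i = 0)"
  using theI'[OF std_rep_ex1[OF assms]] by (auto simp: std_rep_def)

lemma std_rep_equality:
  assumes "P \<in> proj_space n" "a \<in> P" "j \<le> n" "a j = 1" "\<forall>i<j. a i = 0"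
  shows "std_rep n P = a"
  unfolding std_rep_def using assms by (intro the1_equality[OF std_rep_ex1]) auto

locale nested_subfields =
  fixes K :: "nat \<Rightarrow> 'k::{field,finite} set" and n :: nat
  assumes subfield: "i \<le> n \<Longrightarrow> is_subfield (K i)"
    and subset_Suc: "i < n \<Longrightarrow> K i \<subseteq> K (Suc i)"
begin

lemma subset_le:
  assumes "i \<le> j" "j \<le> n"
  shows "K i \<subseteq> K j"
  using assms
proof (induction j)
  case (Suc j)
  then show ?case using subset_Suc[of j] by (cases "i = Suc j") auto
qed simp

lemma
  assumes "i \<le> n"
  shows zero_in: "0 \<in> K i" and one_in: "1 \<in> K i"
    and add_in: "x \<in> K i \<Longrightarrow> y \<in> K i \<Longrightarrow> x + y \<in> K i"
    and mult_in: "x \<in> K i \<Longrightarrow> y \<in> K i \<Longrightarrow> x * y \<in> K i"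
    and uminus_in: "x \<in> K i \<Longrightarrow> - x \<in> K i"
    and inverse_in: "x \<in> K i \<Longrightarrow> inverse x \<in> K i"
  using subfield[OF assms] by (auto simp: is_subfield_def)

lemma diff_in: "i \<le> n \<Longrightarrow> x \<in> K i \<Longrightarrow> y \<in> K i \<Longrightarrow> x - y \<in> K i"
  using add_in[of i x "- y"] uminus_in[of i y] by simp

lemma card_pos: "i \<le> n \<Longrightarrow> card (K i) > 0"
  using zero_in[of i] by (auto simp: card_gt_0_iff)

lemma card_ge_2:
  assumes "i \<le> n"
  shows "card (K i) \<ge> 2"
proof -
  have "card {0, 1 :: 'k} \<le> card (K i)"
    using zero_in[OF assms] one_in[OF assms] by (intro card_mono) auto
  then show ?thesis by simp
qed

definition lead_vectors :: "nat \<Rightarrow> (nat \<Rightarrow> 'k) set" where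
  "lead_vectors j = {x \<in> Pi\<^sub>E {..n} K. x j = 1 \<and> (\<forall>l<j. x l = 0)}"

text \<open>These are the sets S_j of the dimension argument: \<open>std_vectors 0\<close>
  represents all points, and \<open>std_vectors (Suc n)\<close> is empty.\<close>

definition std_vectors :: "nat \<Rightarrow> (nat \<Rightarrow> 'k) set" where
  "std_vectors j = (\<Union>i\<in>{j..n}. lead_vectors i)"

text \<open>The affine chart with leading index \<open>j\<close>, in which only the coordinates
  after \<open>j\<close> are free.\<close>

definition lead_embed :: "nat \<Rightarrow> (nat \<Rightarrow> 'k) \<Rightarrow> nat \<Rightarrow> 'k" where
  "lead_embed j a = (\<lambda>i\<in>{..n}. if i < j then 0 else if i = j then 1 else a i)"

lemma bij_betw_lead_embed:
  assumes "j \<le> n"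
  shows "bij_betw (lead_embed j) (Pi\<^sub>E {j + 1..n} K) (lead_vectors j)"
proof (rule bij_betw_byWitness[where f' = "\<lambda>x. restrict x {j + 1..n}"])
  show "\<forall>a\<in>Pi\<^sub>E {j + 1..n} K. restrict (lead_embed j a) {j + 1..n} = a"
    by (auto simp: lead_embed_def fun_eq_iff restrict_def PiE_def extensional_def)
  show "\<forall>x\<in>lead_vectors j. lead_embed j (restrict x {j + 1..n}) = x"
    by (auto simp: lead_embed_def lead_vectors_def fun_eq_iff restrict_def PiE_def extensional_def)
  show "lead_embed j ` Pi\<^sub>E {j + 1..n} K \<subseteq> lead_vectors j"
    using assms by (auto simp: lead_embed_def lead_vectors_def zero_in one_in PiE_mem split: if_splits)
  show "(\<lambda>x. restrict x {j + 1..n}) ` lead_vectors j \<subseteq> Pi\<^sub>E {j + 1..n} K"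
    by (auto simp: lead_vectors_def PiE_def)
qed

lemma finite_PiE_K: "finite I \<Longrightarrow> finite (Pi\<^sub>E I K)"
  by (intro finite_PiE) auto

lemma finite_lead_vectors: "finite (lead_vectors j)"
  unfolding lead_vectors_def using finite_PiE_K[of "{..n}"] by simp

lemma finite_std_vectors: "finite (std_vectors j)"
  unfolding std_vectors_def using finite_lead_vectors by simp

lemma lead_vectors_disjoint: "i \<noteq> j \<Longrightarrow> lead_vectors i \<inter> lead_vectors j = {}"
  by (cases i j rule: linorder_cases) (auto simp: lead_vectors_def)

lemma std_vectors_rec: "j \<le> n \<Longrightarrow> std_vectors j = lead_vectors j \<union> std_vectors (Suc j)"
  unfolding std_vectors_def by (subst Icc_eq_insert_lb_nat) auto

text \<open>Division by the first nonzero entry stays inside the product because the fields are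
  nested: for \<open>i\<close> at least \<open>m\<close>, \<open>x m\<close> lies in
  \<open>K m\<close> and thus in \<open>K i\<close>, while earlier entries are 0.\<close>

lemma normalize_in:
  assumes "x \<in> Pi\<^sub>E {..n} K" "m \<le> n" "x m \<noteq> 0" "\<And>l. l < m \<Longrightarrow> x l = 0"
  shows "(\<lambda>i\<in>{..n}. inverse (x m) * x i) \<in> lead_vectors m"
proof -
  have "inverse (x m) * x i \<in> K i" if "i \<le> n" for i
  proof (cases "i < m")
    case True
    then show ?thesis using assms(4) zero_in[OF that] by simp
  next
    case False
    then have "x m \<in> K i"
      using subset_le[of m i] that assms(1,2) by (auto simp: PiE_def Pi_def)
    then show ?thesis
      using that assms(1) by (auto simp: PiE_def Pi_def intro!: mult_in inverse_in)
  qed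
  then show ?thesis
    using assms(2-4) by (auto simp: lead_vectors_def)
qed

lemma bij_betw_std_rep: "bij_betw (std_rep n) (proj_product n K) (std_vectors 0)"
proof (rule bij_betwI')
  fix P Q assume PQ: "P \<in> proj_product n K" "Q \<in> proj_product n K"
  then have sp: "P \<in> proj_space n" "Q \<in> proj_space n"
    by (auto simp: proj_product_def)
  have "P = Q" if "std_rep n P = std_rep n Q"
  proof -
    have "std_rep n P \<in> P \<inter> Q"
      using std_rep_in[OF sp(1)] std_rep_in[OF sp(2)] that by simp
    then show ?thesis
      using quotient_disj[OF equiv_proj_rel, of P n Q] sp unfolding proj_space_def by blast
  qed
  then show "(std_rep n P = std_rep n Q) = (P = Q)" by blast
next
  fix P assume "P \<in> proj_product n K"
  then obtain a where P: "P \<in> proj_space n" "a \<in> P" "\<And>i. i \<le> n \<Longrightarrow> a i \<in> K i"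
    by (auto simp: proj_product_def)
  let ?b = "std_rep n P"
  obtain j where j: "j \<le> n" "?b j = 1" "\<forall>i<j. ?b i = 0"
    using std_rep_leading[OF P(1)] by blast
  obtain v where v: "P = proj_rel n `` {v}" "v \<in> nonzero_vectors n"
    using P(1) by (auto simp: proj_space_def quotient_def)
  have "(v, x) \<in> proj_rel n" if "x \<in> P" for x
    using that unfolding v(1) by simp
  then have "(a, ?b) \<in> proj_rel n"
    using std_rep_in[OF P(1)] P(2) equivE[OF equiv_proj_rel[of n]] by (meson symD transD)
  then obtain c where c: "c \<noteq> 0" "\<And>i. i \<le> n \<Longrightarrow> ?b i = c * a i" and
      ext: "?b \<in> nonzero_vectors n" "a \<in> nonzero_vectors n"
    by (auto simp: proj_rel_def)
  \<comment> \<open>\<open>a\<close> is a representative of \<open>P\<close> with entries in the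
    given fields. The factor \<open>c\<close> is the inverse of its first nonzero entry, so
    \<open>?b\<close> is the normalization of \<open>a\<close> and \<open>normalize_in\<close>
    applies.\<close>
  have ca: "c * a j = 1"
    using c(2)[of j] j by simp
  then have "inverse (a j) = c" and "a j \<noteq> 0"
    using inverse_unique[of "a j" c] by (auto simp: mult.commute)
  have a0: "a l = 0" if "l < j" for l
    using c(1) c(2)[of l] j that by auto
  have "(\<lambda>i\<in>{..n}. inverse (a j) * a i) \<in> lead_vectors j"
    using P(3) ext(2) \<open>a j \<noteq> 0\<close> a0 j(1)
    by (intro normalize_in) (auto simp: nonzero_vectors_def PiE_def)
  also have "(\<lambda>i\<in>{..n}. inverse (a j) * a i) = ?b"
    using ext(1) c(2) \<open>inverse (a j) = c\<close>
    by (auto simp: nonzero_vectors_def PiE_def extensional_def restrict_def fun_eq_iff)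
  finally show "?b \<in> std_vectors 0"
    using j(1) by (auto simp: std_vectors_def)
next
  fix x assume "x \<in> std_vectors 0"
  then obtain j where j: "j \<le> n" "x \<in> Pi\<^sub>E {..n} K" "x j = 1" "\<forall>l<j. x l = 0"
    by (auto simp: std_vectors_def lead_vectors_def)
  have nz: "x \<in> nonzero_vectors n"
    using j by (auto simp: nonzero_vectors_def PiE_def intro!: exI[of _ j])
  define P where "P = proj_rel n `` {x}"
  have "P \<in> proj_space n"
    unfolding P_def proj_space_def using nz by (rule quotientI)
  moreover have "x \<in> P"
    unfolding P_def using nz equiv_class_self[OF equiv_proj_rel] by blast
  ultimately show "\<exists>P\<in>proj_product n K. x = std_rep n P"
    using j std_rep_equality[of P n x j]
    by (intro bexI[of _ P]) (auto simp: proj_product_def intro!: bexI[of _ x])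
qed

section \<open>Charts, the number of points and the dimension\<close>

lemma tail_product_eq: "j \<le> n \<Longrightarrow> tail_product n K (n - j) = Pi\<^sub>E {j + 1..n} K"
  by (simp add: tail_product_def)

lemma tail_code_eq: "j \<le> n \<Longrightarrow> tail_code n K (n - j) e = affine_code {j + 1..n} K e"
  by (simp add: tail_code_def)

text \<open>The standard representatives are partitioned by the position \<open>j\<close> of the
  leading 1, and the part for \<open>j\<close> is a copy of the tail product with
  \<open>n - j\<close> factors; reversing the sum gives the stated order.\<close>

lemma card_proj_product: "card (proj_product n K) = (\<Sum>i=0..n. card (tail_product n K i))"
proof -
  have "card (proj_product n K) = card (std_vectors 0)"
    by (rule bij_betw_same_card[OF bij_betw_std_rep])
  also have "\<dots> = (\<Sum>j=0..n. card (lead_vectors j))"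
    unfolding std_vectors_def using finite_lead_vectors lead_vectors_disjoint
    by (intro card_UN_disjoint) auto
  also have "\<dots> = (\<Sum>j=0..n. card (tail_product n K (n - j)))"
    using bij_betw_same_card[OF bij_betw_lead_embed] tail_product_eq by (intro sum.cong) auto
  also have "\<dots> = (\<Sum>i=0..n. card (tail_product n K i))"
    using sum.atLeastAtMost_rev[of "\<lambda>i. card (tail_product n K i)" 0 n] by simp
  finally show ?thesis .
qed

text \<open>A nonzero vector of the product whose first \<open>j\<close> entries are 0 is a multiple
  of an element of \<open>std_vectors j\<close>, and homogeneity transfers the zero. At the zero
  vector any form of positive degree vanishes.\<close>

lemma vanishing_on_std_vectors:
  assumes f: "f \<in> poly_funs {..n} {d}" and "d \<ge> 1"
    and van: "\<And>x. x \<in> std_vectors j \<Longrightarrow> f x = 0"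
    and x: "x \<in> Pi\<^sub>E {..n} K" "\<And>l. l < j \<Longrightarrow> x l = 0"
  shows "f x = 0"
proof (cases "\<forall>i\<le>n. x i = 0")
  case True
  then show ?thesis
    using poly_funs_homogeneous[OF f, of x 0 x] \<open>d \<ge> 1\<close> by (simp add: power_0_left)
next
  case False
  define m where "m = (LEAST i. x i \<noteq> 0 \<and> i \<le> n)"
  have ex: "\<exists>i. x i \<noteq> 0 \<and> i \<le> n"
    using False by blast
  have m: "x m \<noteq> 0" "m \<le> n"
    using LeastI_ex[OF ex] by (auto simp: m_def)
  have below: "x l = 0" if "l < m" for l
    using not_less_Least[OF that[unfolded m_def]] that m(2) by auto
  have "j \<le> m"
    using m(1) x(2) not_le by blast
  then have "(\<lambda>i\<in>{..n}. inverse (x m) * x i) \<in> std_vectors j"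
    using normalize_in[OF x(1) m(2,1) below] m(2) by (auto simp: std_vectors_def)
  then have "f (\<lambda>i\<in>{..n}. inverse (x m) * x i) = 0"
    by (rule van)
  moreover have "f (\<lambda>i\<in>{..n}. inverse (x m) * x i) = inverse (x m) ^ d * f x"
    by (rule poly_funs_homogeneous[OF f]) simp
  ultimately show ?thesis using m(1) by simp
qed

text \<open>This counts the exact sequence given by restriction from S_j to S_(j+1): its kernel,
  read in the chart with leading index \<open>j\<close>, is the affine code of degree
  \<open>d - 1\<close>.\<close>

lemma card_std_code_rec:
  assumes "d \<ge> 1" "j \<le> n"
  shows "card (restr (std_vectors j) ` poly_funs {..n} {d}) =
    card (restr (std_vectors (Suc j)) ` poly_funs {..n} {d}) * card (affine_code {j + 1..n} K (d - 1))"
proof -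
  let ?S = "std_vectors" and ?H = "poly_funs {..n} {d} :: ((nat \<Rightarrow> 'k) \<Rightarrow> 'k) set"
  let ?V = "restr (?S j) ` ?H"
  let ?A = "Pi\<^sub>E {j + 1..n} K"
  have sub: "?S (Suc j) \<subseteq> ?S j"
    unfolding std_vectors_def by (intro UN_mono) auto
  define ker where "ker = {w \<in> ?V. restr (?S (Suc j)) w = 0}"
  have "card ?V = card (restr (?S (Suc j)) ` ?V) * card ker"
    unfolding ker_def
    by (intro card_eq_card_image_times_kernel subspace_restr_image poly_funs_subspace
        finite_restr_image finite_std_vectors) (auto simp: restr_def)
  moreover have "restr (?S (Suc j)) ` ?V = restr (?S (Suc j)) ` ?H"
    unfolding image_image using sub by (intro image_cong) (auto simp: restr_def fun_eq_iff)
  moreover have "card ker = card (affine_code {j + 1..n} K (d - 1))"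
  proof (rule bij_betw_same_card)
    let ?\<Phi> = "\<lambda>w. restr ?A (\<lambda>a. w (lead_embed j a))"
    \<comment> \<open>A word of the kernel is supported on the chart \<open>lead_vectors j\<close>,
      so its pullback \<open>?\<Phi>\<close> loses no information.\<close>
    have vanish: "w x = 0" if "w \<in> ker" "x \<notin> lead_vectors j" for w x
    proof -
      have "restr (?S (Suc j)) w = 0" and "w \<in> ?V"
        using that(1) unfolding ker_def by blast+
      then have "x \<in> ?S (Suc j) \<Longrightarrow> w x = 0" and "x \<notin> ?S j \<Longrightarrow> w x = 0"
        by (auto simp: restr_def dest: fun_cong[of _ _ x])
      then show ?thesis
        using that(2) std_vectors_rec[OF assms(2)] by blast
    qed
    have emb: "lead_embed j a \<in> lead_vectors j" if "a \<in> ?A" for a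
      using bij_betw_lead_embed[OF assms(2)] that by (auto simp: bij_betw_def)
    show "bij_betw ?\<Phi> ker (affine_code {j + 1..n} K (d - 1))"
      unfolding bij_betw_def
    proof (intro conjI inj_onI equalityI subsetI)
      fix v w assume vw: "v \<in> ker" "w \<in> ker" "?\<Phi> v = ?\<Phi> w"
      show "v = w"
      proof
        fix x
        show "v x = w x"
        proof (cases "x \<in> lead_vectors j")
          case True
          then obtain a where a: "a \<in> ?A" "x = lead_embed j a"
            using bij_betw_lead_embed[OF assms(2)] by (auto simp: bij_betw_def)
          then show ?thesis
            using fun_cong[OF vw(3), of a] by (simp add: restr_def)
        qed (simp add: vanish[OF vw(1)] vanish[OF vw(2)])
      qed
    next
      fix y assume "y \<in> ?\<Phi> ` ker"
      then obtain f where f: "f \<in> ?H" and y: "y = ?\<Phi> (restr (?S j) f)"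
        and 0: "restr (?S (Suc j)) (restr (?S j) f) = 0"
        by (auto simp: ker_def)
      have f0: "f x = 0" if "x \<in> ?S (Suc j)" for x
        using fun_cong[OF 0, of x] that sub by (auto simp: restr_def)
      \<comment> \<open>Setting the coordinates before \<open>j\<close> to 0 and coordinate
        \<open>j\<close> to 1 would by itself only give degree at most \<open>d\<close>. The
        subtracted term lowers the degree by \<open>poly_funs_partial_eval\<close>, and it is 0 on
        the product because \<open>f\<close> vanishes on S_(j+1).\<close>
      define g where "g = (\<lambda>b. f (\<lambda>i. if i \<in> {..j} then (if i = j then 1 else 0) else b i) -
        f (\<lambda>i. if i \<in> {..j} then 0 else b i))"
      have "g \<in> poly_funs ({..n} - {..j}) {..d - 1}"
        unfolding g_def by (rule poly_funs_partial_eval[OF f assms(1)])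
      also have "{..n} - {..j} = {j + 1..n}" by auto
      finally have "g \<in> poly_funs {j + 1..n} {..d - 1}" .
      moreover have "y = restr ?A g"
      proof
        fix a
        show "y a = restr ?A g a"
        proof (cases "a \<in> ?A")
          case True
          have "f (\<lambda>i. if i \<in> {..j} then 0 else a i) =
              f (\<lambda>i\<in>{..n}. if i \<in> {..j} then 0 else a i)"
            by (rule poly_funs_cong[OF f]) auto
          also have "\<dots> = 0"
            using True by (intro vanishing_on_std_vectors[OF f assms(1) f0]) (use assms(2) in \<open>auto simp: zero_in PiE_mem\<close>)
          finally have "g a = f (\<lambda>i. if i \<in> {..j} then (if i = j then 1 else 0) else a i)"
            by (simp add: g_def)
          also have "\<dots> = f (lead_embed j a)"
            by (rule poly_funs_cong[OF f]) (auto simp: lead_embed_def)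
          finally show ?thesis
            using True emb[OF True] std_vectors_rec[OF assms(2)] by (simp add: y restr_def)
        qed (simp add: y restr_def)
      qed
      ultimately show "y \<in> affine_code {j + 1..n} K (d - 1)"
        by (auto simp: affine_code_eq)
    next
      fix y assume "y \<in> affine_code {j + 1..n} K (d - 1)"
      then obtain g where g: "g \<in> poly_funs {j + 1..n} {..d - 1}" and y: "y = restr ?A g"
        by (auto simp: affine_code_eq)
      \<comment> \<open>Homogenizing with coordinate \<open>j\<close> gives a form that vanishes on
        S_(j+1), where this coordinate is 0; its word therefore lies in the kernel.\<close>
      obtain f where f: "f \<in> ?H" "\<And>x. x j = 0 \<Longrightarrow> f x = 0" "\<And>x. x j = 1 \<Longrightarrow> f x = g x"
        using ex_homogenization[OF g assms(1), of j "{..n}"] assms(2) by auto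
      have "restr (?S (Suc j)) (restr (?S j) f) = 0"
        using f(2) by (auto simp: restr_def fun_eq_iff std_vectors_def lead_vectors_def)
      then have "restr (?S j) f \<in> ker"
        using f(1) by (auto simp: ker_def)
      moreover have "y = ?\<Phi> (restr (?S j) f)"
      proof
        fix a
        show "y a = ?\<Phi> (restr (?S j) f) a"
        proof (cases "a \<in> ?A")
          case True
          have "f (lead_embed j a) = g (lead_embed j a)"
            using assms(2) by (intro f(3)) (simp add: lead_embed_def)
          also have "\<dots> = g a"
            by (rule poly_funs_cong[OF g]) (auto simp: lead_embed_def)
          finally show ?thesis
            using True emb[OF True] std_vectors_rec[OF assms(2)] by (simp add: y restr_def)
        qed (simp add: y restr_def)
      qed
      ultimately show "y \<in> ?\<Phi> ` ker" by blast
    qed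
  qed
  ultimately show ?thesis by simp
qed

lemma proj_code_eq:
  "proj_code n K d = (\<lambda>f. restr (proj_product n K) (\<lambda>P. f (std_rep n P))) ` poly_funs {..n} {d}"
  unfolding proj_code_def mpoly_eval_homogeneous[symmetric] image_image restr_def ..

lemma subspace_proj_code: "word_space.subspace (proj_code n K d)"
proof -
  let ?L = "\<lambda>f :: (nat \<Rightarrow> 'k) \<Rightarrow> 'k. restr (proj_product n K) (\<lambda>P. f (std_rep n P))"
  let ?H = "poly_funs {..n} {d} :: ((nat \<Rightarrow> 'k) \<Rightarrow> 'k) set"
  show ?thesis
    unfolding proj_code_eq
  proof (rule word_space.subspaceI)
    have "?L (\<lambda>_. 0) = 0" by (auto simp: restr_def)
    then show "0 \<in> ?L ` ?H"
      using poly_funs_0 by force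
  next
    fix x y assume "x \<in> ?L ` ?H" "y \<in> ?L ` ?H"
    then obtain f g where "f \<in> ?H" "g \<in> ?H" "x = ?L f" "y = ?L g" by blast
    moreover have "?L f + ?L g = ?L (\<lambda>a. f a + g a)"
      by (auto simp: restr_def)
    ultimately show "x + y \<in> ?L ` ?H"
      using poly_funs_add[of f "{..n}" "{d}" g] by auto
  next
    fix c x assume "x \<in> ?L ` ?H"
    then obtain f where "f \<in> ?H" "x = ?L f" by blast
    moreover have "word_scale c (?L f) = ?L (\<lambda>a. c * f a)"
      by (auto simp: restr_def word_scale_def)
    ultimately show "word_scale c x \<in> ?L ` ?H"
      using poly_funs_scale[of f "{..n}" "{d}" c] by auto
  qed
qed

lemma finite_proj_product: "finite (proj_product n K)"
  using bij_betw_finite[OF bij_betw_std_rep] finite_std_vectors by blast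

lemma card_proj_code: "card (proj_code n K d) = card (restr (std_vectors 0) ` poly_funs {..n} {d})"
proof (rule bij_betw_same_card[symmetric])
  let ?S = "std_vectors 0" and ?H = "poly_funs {..n} {d} :: ((nat \<Rightarrow> 'k) \<Rightarrow> 'k) set"
  let ?\<Psi> = "\<lambda>w. restr (proj_product n K) (\<lambda>P. w (std_rep n P))"
  have S: "std_rep n ` proj_product n K = ?S"
    using bij_betw_std_rep by (simp add: bij_betw_def)
  have "inj_on ?\<Psi> (restr ?S ` ?H)"
  proof (rule inj_onI)
    fix v w assume vw: "v \<in> restr ?S ` ?H" "w \<in> restr ?S ` ?H" "?\<Psi> v = ?\<Psi> w"
    show "v = w"
    proof
      fix x
      show "v x = w x"
      proof (cases "x \<in> ?S")
        case True
        then obtain P where "P \<in> proj_product n K" "x = std_rep n P"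
          using S by blast
        then show ?thesis
          using fun_cong[OF vw(3), of P] by (simp add: restr_def)
      qed (use vw in \<open>auto simp: restr_def\<close>)
    qed
  qed
  moreover have "?\<Psi> (restr ?S f) = ?\<Psi> f" for f :: "(nat \<Rightarrow> 'k) \<Rightarrow> 'k"
    using S by (auto simp: restr_def fun_eq_iff)
  then have "?\<Psi> ` restr ?S ` ?H = proj_code n K d"
    by (simp add: proj_code_eq image_image)
  ultimately show "bij_betw ?\<Psi> (restr ?S ` ?H) (proj_code n K d)"
    by (simp add: bij_betw_def)
qed

lemma finite_proj_code: "finite (proj_code n K d)"
proof -
  have "proj_code n K d \<subseteq> restr (proj_product n K) ` UNIV"
    unfolding proj_code_eq by auto
  then show ?thesis
    using finite_restr_image[OF finite_proj_product] finite_subset by blast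
qed

lemma code_dim_proj_code:
  assumes "d \<ge> 1"
  shows "code_dim (proj_code n K d) = (\<Sum>i=0..n. code_dim (tail_code n K i (d - 1)))"
proof -
  have affine: "card (affine_code {j + 1..n} K e) = card (UNIV :: 'k set) ^ code_dim (affine_code {j + 1..n} K e)" for j e
    unfolding affine_code_eq
    by (intro card_subspace subspace_restr_image poly_funs_subspace finite_restr_image finite_PiE_K) simp
  \<comment> \<open>The induction starts at the empty set S_(n+1), whose code is zero, and moves
    down; passing from S_(n+1-k) to S_(n-k) contributes the affine code in \<open>k\<close>
    variables.\<close>
  have "card (restr (std_vectors (Suc n - k)) ` poly_funs {..n} {d}) =
      card (UNIV :: 'k set) ^ (\<Sum>i<k. code_dim (tail_code n K i (d - 1)))" if "k \<le> Suc n" for k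
    using that
  proof (induction k)
    case 0
    have "restr (std_vectors (Suc n)) ` poly_funs {..n} {d} = {0}"
      using poly_funs_0 by (force simp: restr_def std_vectors_def)
    then show ?case by simp
  next
    case (Suc k)
    have "tail_code n K k (d - 1) = affine_code {n - k + 1..n} K (d - 1)"
      using tail_code_eq[of "n - k" "d - 1"] Suc.prems by simp
    then show ?case
      using Suc card_std_code_rec[OF assms, of "n - k"] affine[of "n - k" "d - 1"]
      by (simp add: Suc_diff_le power_add)
  qed
  from this[of "Suc n"] have "card (UNIV :: 'k set) ^ code_dim (proj_code n K d) =
      card (UNIV :: 'k set) ^ (\<Sum>i<Suc n. code_dim (tail_code n K i (d - 1)))"
    using card_subspace[OF subspace_proj_code finite_proj_code, of d] card_proj_code[of d] by simp
  moreover have "card (UNIV :: 'k set) > 1"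
    using card_ge_2[of 0] card_mono[of "UNIV :: 'k set" "K 0"] by simp
  ultimately have "code_dim (proj_code n K d) = (\<Sum>i<Suc n. code_dim (tail_code n K i (d - 1)))"
    by (simp only: power_inject_exp)
  then show ?thesis
    by (simp only: lessThan_Suc_atMost atLeast0AtMost)
qed

end

section \<open>Minimum distance\<close>

lemma min_distance_le: "w \<in> C \<Longrightarrow> w \<noteq> (\<lambda>_. 0) \<Longrightarrow> min_distance C \<le> weight w"
  unfolding min_distance_def by (intro Least_le) blast

lemma min_distance_attained:
  assumes "w \<in> C" "w \<noteq> (\<lambda>_. 0)"
  obtains v where "v \<in> C" "v \<noteq> (\<lambda>_. 0)" "weight v = min_distance C"
proof -
  have "\<exists>v\<in>C. v \<noteq> (\<lambda>_. 0) \<and> min_distance C = weight v"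
    unfolding min_distance_def by (rule LeastI_ex) (use assms in blast)
  then show ?thesis using that by metis
qed

lemma weight_restr: "weight (restr S f) = card {p \<in> S. f p \<noteq> 0}"
  unfolding weight_def restr_def by (rule arg_cong[where f = card]) auto

lemma restr_eq_0_iff: "restr S f = (\<lambda>_. 0) \<longleftrightarrow> (\<forall>p\<in>S. f p = 0)"
  by (auto simp: restr_def fun_eq_iff)

context nested_subfields
begin

abbreviation affine_dist :: "nat set \<Rightarrow> nat \<Rightarrow> nat" where
  "affine_dist I e \<equiv> min_distance (affine_code I K e)"

lemma affine_dist_le:
  assumes "g \<in> poly_funs I {..e}" "a \<in> Pi\<^sub>E I K" "g a \<noteq> 0"
  shows "affine_dist I e \<le> card {a \<in> Pi\<^sub>E I K. g a \<noteq> 0}"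
  using min_distance_le[of "restr (Pi\<^sub>E I K) g" "affine_code I K e"] assms
  by (auto simp: affine_code_eq weight_restr restr_eq_0_iff)

lemma zero_vector_in: "I \<subseteq> {..n} \<Longrightarrow> (\<lambda>i\<in>I. 0) \<in> Pi\<^sub>E I K"
  by (auto simp: zero_in)

lemma affine_dist_attained:
  assumes "I \<subseteq> {..n}"
  obtains g a where "g \<in> poly_funs I {..e}" "a \<in> Pi\<^sub>E I K" "g a \<noteq> 0"
    "card {a \<in> Pi\<^sub>E I K. g a \<noteq> 0} = affine_dist I e"
proof -
  \<comment> \<open>The constant word 1 guarantees that a nonzero word exists, so that the
    \<open>LEAST\<close> in \<open>min_distance\<close> is attained.\<close>
  have "restr (Pi\<^sub>E I K) (\<lambda>_. 1) \<in> affine_code I K e"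
    unfolding affine_code_eq by (intro imageI poly_funs_const) simp
  moreover have "restr (Pi\<^sub>E I K) (\<lambda>_. 1 :: 'k) \<noteq> (\<lambda>_. 0)"
    unfolding restr_eq_0_iff using zero_vector_in[OF assms] by (meson one_neq_zero)
  ultimately obtain v where v: "v \<in> affine_code I K e" "v \<noteq> (\<lambda>_. 0)"
    "weight v = affine_dist I e"
    by (rule min_distance_attained)
  then show ?thesis
    using that by (auto simp: affine_code_eq weight_restr restr_eq_0_iff)
qed

lemma weight_proj_word:
  "weight (restr (proj_product n K) (\<lambda>P. f (std_rep n P))) = card {x \<in> std_vectors 0. f x \<noteq> 0}"
proof -
  have "bij_betw (std_rep n) {P \<in> proj_product n K. f (std_rep n P) \<noteq> 0} {x \<in> std_vectors 0. f x \<noteq> 0}"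
    using bij_betw_std_rep unfolding bij_betw_def inj_on_def by auto
  then show ?thesis
    unfolding weight_restr by (rule bij_betw_same_card)
qed

lemma proj_word_eq_0_iff:
  "restr (proj_product n K) (\<lambda>P. f (std_rep n P)) = (\<lambda>_. 0) \<longleftrightarrow> (\<forall>x\<in>std_vectors 0. f x = 0)"
proof -
  have "std_vectors 0 = std_rep n ` proj_product n K"
    using bij_betw_std_rep by (simp add: bij_betw_def)
  then show ?thesis
    unfolding restr_eq_0_iff by simp
qed

section \<open>Upper bounds for affine minimum distances\<close>

lemma card_fibres:
  assumes "finite I" "finite J" "I \<inter> J = {}"
  shows "card {a \<in> Pi\<^sub>E (I \<union> J) K. P a} =
    (\<Sum>c\<in>Pi\<^sub>E I K. card {b \<in> Pi\<^sub>E J K. P (\<lambda>i. if i \<in> I then c i else b i)})"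
proof -
  let ?m = "\<lambda>(c, b) i. if i \<in> I then c i else b i"
  let ?S = "SIGMA c:Pi\<^sub>E I K. {b \<in> Pi\<^sub>E J K. P (\<lambda>i. if i \<in> I then c i else b i)}"
  have merge: "(\<lambda>i. if i \<in> I then restrict a I i else restrict a J i) = a" if "a \<in> Pi\<^sub>E (I \<union> J) K" for a
    using that by (auto simp: fun_eq_iff PiE_def extensional_def)
  have "bij_betw ?m ?S {a \<in> Pi\<^sub>E (I \<union> J) K. P a}"
  proof (rule bij_betw_byWitness[where f' = "\<lambda>a. (restrict a I, restrict a J)"])
    show "\<forall>x\<in>?S. (\<lambda>a. (restrict a I, restrict a J)) (?m x) = x"
      using assms(3) by (auto simp: fun_eq_iff PiE_def extensional_def restrict_def)
    show "\<forall>a\<in>{a \<in> Pi\<^sub>E (I \<union> J) K. P a}. ?m (restrict a I, restrict a J) = a"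
      using merge by simp
    show "?m ` ?S \<subseteq> {a \<in> Pi\<^sub>E (I \<union> J) K. P a}"
      by (auto simp: PiE_def extensional_def Pi_def)
    show "(\<lambda>a. (restrict a I, restrict a J)) ` {a \<in> Pi\<^sub>E (I \<union> J) K. P a} \<subseteq> ?S"
      using merge by auto
  qed
  then have "card {a \<in> Pi\<^sub>E (I \<union> J) K. P a} = card ?S"
    by (simp add: bij_betw_same_card)
  also have "\<dots> = (\<Sum>c\<in>Pi\<^sub>E I K. card {b \<in> Pi\<^sub>E J K. P (\<lambda>i. if i \<in> I then c i else b i)})"
    using finite_PiE_K assms by (intro card_SigmaI) auto
  finally show ?thesis .
qed

text \<open>A polynomial of minimal weight in the variables \<open>J\<close> is read as a polynomial
  in \<open>I \<union> J\<close>; each of its nonzeros is then repeated once for every point of the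
  \<open>I\<close>-factor.\<close>

lemma affine_dist_Un_le:
  assumes "finite I" "finite J" "I \<inter> J = {}" "I \<union> J \<subseteq> {..n}"
  shows "affine_dist (I \<union> J) e \<le> card (Pi\<^sub>E I K) * affine_dist J e"
proof -
  obtain g a where g: "g \<in> poly_funs J {..e}" "a \<in> Pi\<^sub>E J K" "g a \<noteq> 0"
    "card {a \<in> Pi\<^sub>E J K. g a \<noteq> 0} = affine_dist J e"
    using affine_dist_attained[of J e] assms(4) by blast
  have eq: "g (\<lambda>i. if i \<in> I then c i else b i) = g b" for b c
    by (rule poly_funs_cong[OF g(1)]) (use assms(3) in auto)
  let ?a = "\<lambda>i. if i \<in> I then (\<lambda>i\<in>I. 0) i else a i"
  have "?a \<in> Pi\<^sub>E (I \<union> J) K"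
    using g(2) assms(4) by (auto simp: PiE_def extensional_def Pi_def intro: zero_in)
  moreover have "g ?a \<noteq> 0"
    unfolding eq by (rule g(3))
  moreover have "g \<in> poly_funs (I \<union> J) {..e}"
    using g(1) poly_funs_mono[of J "I \<union> J" "{..e}" "{..e}"] by blast
  ultimately have "affine_dist (I \<union> J) e \<le> card {a \<in> Pi\<^sub>E (I \<union> J) K. g a \<noteq> 0}"
    by (intro affine_dist_le[where a = ?a])
  also have "\<dots> = card (Pi\<^sub>E I K) * affine_dist J e"
    by (simp only: card_fibres[OF assms(1-3)] eq g(4) sum_constant of_nat_id)
  finally show ?thesis .
qed

text \<open>The bound is the weight of a product of linear factors x_i - s, with \<open>u i\<close>
  distinct elements s of \<open>K i\<close> for each \<open>i\<close>. Its nonzeros form a box with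
  \<open>card (K i) - u i\<close> values in direction \<open>i\<close>, and
  \<open>u i < card (K i)\<close> keeps the box nonempty.\<close>

lemma affine_dist_le_prod:
  assumes "finite I" "I \<subseteq> {..n}"
    and u: "\<And>i. i \<in> I \<Longrightarrow> u i < card (K i)" "(\<Sum>i\<in>I. u i) \<le> e"
  shows "affine_dist I e \<le> (\<Prod>i\<in>I. card (K i) - u i)"
proof -
  have "\<exists>T. T \<subseteq> K i \<and> card T = u i" if "i \<in> I" for i
    using obtain_subset_with_card_n[OF less_imp_le[OF u(1)[OF that]]] by blast
  then obtain S where S: "\<And>i. i \<in> I \<Longrightarrow> S i \<subseteq> K i" "\<And>i. i \<in> I \<Longrightarrow> card (S i) = u i"
    by metis
  define g where "g = (\<lambda>a :: nat \<Rightarrow> 'k. \<Prod>i\<in>I. \<Prod>s\<in>S i. a i - s)"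
  have lin: "(\<lambda>a :: nat \<Rightarrow> 'k. \<Prod>s\<in>T. a i - s) \<in> poly_funs I {..card T}" if "i \<in> I" for T i
  proof (use finite[of T] in \<open>induction T rule: finite_induct\<close>)
    case empty
    show ?case by (simp add: poly_funs_const)
  next
    case (insert s T)
    have "(\<lambda>a. a i - s) \<in> poly_funs I {..1}"
      using that by (intro poly_funs_diff poly_funs_var poly_funs_const) auto
    from poly_funs_mult[OF this insert.IH, of "{..Suc (card T)}"] show ?case
      using insert.hyps by simp
  qed
  have "(\<lambda>a :: nat \<Rightarrow> 'k. \<Prod>i\<in>J. \<Prod>s\<in>S i. a i - s) \<in> poly_funs I {..\<Sum>i\<in>J. card (S i)}"
    if "finite J" "J \<subseteq> I" for J
    using that
  proof (induction J rule: finite_induct)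
    case empty
    show ?case by (simp add: poly_funs_const)
  next
    case (insert j J)
    then show ?case
      using poly_funs_mult[OF lin[of j "S j"], of _ "{..\<Sum>i\<in>J. card (S i)}" "{..\<Sum>i\<in>insert j J. card (S i)}"]
      by (simp add: add_mono)
  qed
  from this[OF assms(1) subset_refl] have "g \<in> poly_funs I {..\<Sum>i\<in>I. u i}"
    using S(2) unfolding g_def by simp
  then have g: "g \<in> poly_funs I {..e}"
    using poly_funs_mono[of I I "{..\<Sum>i\<in>I. u i}" "{..e}"] u(2) by auto
  have eq: "{a \<in> Pi\<^sub>E I K. g a \<noteq> 0} = Pi\<^sub>E I (\<lambda>i. K i - S i)"
    using assms(1) by (auto simp: g_def PiE_def Pi_def)
  have card: "card (K i - S i) = card (K i) - u i" if "i \<in> I" for i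
    using S[OF that] by (simp add: card_Diff_subset)
  have "K i - S i \<noteq> {}" if "i \<in> I" for i
    using card[OF that] u(1)[OF that] card_gt_0_iff[of "K i - S i"] by simp
  then obtain a where "a \<in> Pi\<^sub>E I (\<lambda>i. K i - S i)"
    using PiE_eq_empty_iff[of I "\<lambda>i. K i - S i"] by auto
  then have "affine_dist I e \<le> card (Pi\<^sub>E I (\<lambda>i. K i - S i))"
    using affine_dist_le[OF g, of a] eq by auto
  also have "\<dots> = (\<Prod>i\<in>I. card (K i) - u i)"
    using assms(1) card by (simp add: card_PiE)
  finally show ?thesis .
qed

section \<open>Lower bounds for the number of vectors at which a form is nonzero\<close>

lemma card_twice_le:
  assumes "i \<le> j" "j \<le> n" "K i \<noteq> K j"
  shows "2 * card (K i) \<le> card (K j)"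
proof -
  obtain x where x: "x \<in> K j" "x \<notin> K i"
    using subset_le[OF assms(1,2)] assms(3) by blast
  \<comment> \<open>The translate of the additive group \<open>K i\<close> by an element outside it
    is disjoint from it, and both lie in \<open>K j\<close>.\<close>
  have "K i \<inter> (+) x ` K i = {}"
  proof -
    have "x \<in> K i" if "y \<in> K i" "x + y \<in> K i" for y
      using diff_in[OF _ that(2,1)] assms(1,2) by simp
    then show ?thesis using x by blast
  qed
  then have "card (K i \<union> (+) x ` K i) = 2 * card (K i)"
    by (subst card_Un_disjoint) (auto simp: card_image)
  moreover have "K i \<union> (+) x ` K i \<subseteq> K j"
    using subset_le[OF assms(1,2)] x add_in[OF assms(2)] by auto
  ultimately show ?thesis
    using card_mono[of "K j" "K i \<union> (+) x ` K i"] by simp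
qed

text \<open>Each nonzero in the chart x_0 = 1 yields \<open>card (K 0) - 1\<close> vectors by
  scaling with nonzero elements of \<open>K 0\<close>; coordinate 0 recovers the scalar, so no
  vector is produced twice. Vectors, unlike standard representatives, are permuted by the linear
  changes of coordinates used below.\<close>

lemma card_affine_chart_le:
  assumes f: "f \<in> poly_funs {..n} {d}"
  shows "(card (K 0) - 1) * card {a \<in> Pi\<^sub>E {1..n} K. f (lead_embed 0 a) \<noteq> 0} \<le>
    card {v \<in> Pi\<^sub>E {..n} K. f v \<noteq> 0}"
proof -
  let ?A = "{a \<in> Pi\<^sub>E {1..n} K. f (lead_embed 0 a) \<noteq> 0}"
  let ?\<psi> = "\<lambda>(t, a). \<lambda>i\<in>{..n}. t * lead_embed 0 a i"
  have emb: "lead_embed 0 a i \<in> K i" if "a \<in> Pi\<^sub>E {1..n} K" "i \<le> n" for a i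
    using that by (auto simp: lead_embed_def one_in PiE_mem)
  have "card ((K 0 - {0}) \<times> ?A) \<le> card {v \<in> Pi\<^sub>E {..n} K. f v \<noteq> 0}"
  proof (rule card_inj_on_le)
    show "inj_on ?\<psi> ((K 0 - {0}) \<times> ?A)"
    proof (rule inj_onI)
      fix p p' assume p: "p \<in> (K 0 - {0}) \<times> ?A" "p' \<in> (K 0 - {0}) \<times> ?A" "?\<psi> p = ?\<psi> p'"
      obtain t a s b where ts: "p = (t, a)" "p' = (s, b)"
        by fastforce
      have eq: "t * lead_embed 0 a i = s * lead_embed 0 b i" if "i \<le> n" for i
        using fun_cong[OF p(3), of i] that by (simp add: ts)
      have "t = s"
        using eq[of 0] by (simp add: lead_embed_def)
      moreover have "a i = b i" if "i \<in> {1..n}" for i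
        using eq[of i] that \<open>t = s\<close> p(1) by (simp add: lead_embed_def ts)
      then have "a = b"
        using p(1,2) by (intro PiE_ext[of a "{1..n}" K b]) (auto simp: ts)
      ultimately show "p = p'" by (simp add: ts)
    qed
    show "?\<psi> ` ((K 0 - {0}) \<times> ?A) \<subseteq> {v \<in> Pi\<^sub>E {..n} K. f v \<noteq> 0}"
    proof (rule image_subsetI)
      fix p assume p: "p \<in> (K 0 - {0}) \<times> ?A"
      obtain t a where ta: "p = (t, a)" by fastforce
      have H: "t \<in> K 0" "t \<noteq> 0" "a \<in> Pi\<^sub>E {1..n} K" "f (lead_embed 0 a) \<noteq> 0"
        using p by (auto simp: ta)
      have "f (\<lambda>i\<in>{..n}. t * lead_embed 0 a i) = t ^ d * f (lead_embed 0 a)"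
        by (rule poly_funs_homogeneous[OF f]) simp
      moreover have "t * lead_embed 0 a i \<in> K i" if "i \<le> n" for i
        using H emb[OF H(3)] subset_le[of 0 i] that by (intro mult_in) auto
      ultimately show "?\<psi> p \<in> {v \<in> Pi\<^sub>E {..n} K. f v \<noteq> 0}"
        using H(2,4) by (simp add: ta)
    qed
    show "finite {v \<in> Pi\<^sub>E {..n} K. f v \<noteq> 0}"
      using finite_PiE_K by simp
  qed
  then show ?thesis
    using zero_in[of 0] by (simp add: card_cartesian_product card_Diff_singleton)
qed

text \<open>The chart x_0 = 1 is cut into the slices given by \<open>c\<close>. By
  \<open>van\<close>, a nonzero of \<open>f\<close> in a slice has x_0 different from 0, so it can
  be scaled into the chart, where \<open>f\<close> is a nonzero function of degree at most
  \<open>d - 1\<close> in the last \<open>n - k\<close> variables. The sum of the slice bounds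
  dominates the affine distance in all \<open>n\<close> variables by
  \<open>affine_dist_Un_le\<close>.\<close>

lemma card_ge_affine_dist_of_slices:
  assumes f: "f \<in> poly_funs {..n} {d}" and "d \<ge> 1" "k \<le> n"
    and van: "\<And>v. v \<in> Pi\<^sub>E {..n} K \<Longrightarrow> (\<And>i. i \<le> k \<Longrightarrow> v i = 0) \<Longrightarrow> f v = 0"
    and slice: "\<And>c. c \<in> Pi\<^sub>E {1..k} K \<Longrightarrow>
      \<exists>v\<in>Pi\<^sub>E {..n} K. (\<forall>i\<in>{1..k}. v i = c i * v 0) \<and> f v \<noteq> 0"
  shows "(card (K 0) - 1) * affine_dist {1..n} (d - 1) \<le> card {v \<in> Pi\<^sub>E {..n} K. f v \<noteq> 0}"
proof -
  let ?h = "\<lambda>a. f (lead_embed 0 a)"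
  let ?m = "\<lambda>c b i. if i \<in> {1..k} then c i else b i"
  have bound: "affine_dist {k + 1..n} (d - 1) \<le> card {b \<in> Pi\<^sub>E {k + 1..n} K. ?h (?m c b) \<noteq> 0}"
    if c: "c \<in> Pi\<^sub>E {1..k} K" for c
  proof -
    obtain v where v: "v \<in> Pi\<^sub>E {..n} K" "\<And>i. i \<in> {1..k} \<Longrightarrow> v i = c i * v 0" "f v \<noteq> 0"
      using slice[OF c] by blast
    have "v 0 \<noteq> 0"
    proof
      assume "v 0 = 0"
      then have "v i = 0" if "i \<le> k" for i
        using v(2)[of i] that by (cases "i = 0") auto
      then show False using van[OF v(1)] v(3) by blast
    qed
    define x where "x = (\<lambda>i\<in>{..n}. inverse (v 0) * v i)"
    have x: "x \<in> lead_vectors 0"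
      unfolding x_def using v(1) \<open>v 0 \<noteq> 0\<close> by (intro normalize_in) auto
    have "f x = inverse (v 0) ^ d * f v"
      unfolding x_def by (rule poly_funs_homogeneous[OF f]) simp
    then have "f x \<noteq> 0"
      using v(3) \<open>v 0 \<noteq> 0\<close> by simp
    \<comment> \<open>As in the dimension argument, the subtracted term lowers the degree and is 0
      on the product, here by \<open>van\<close>.\<close>
    define g where "g = (\<lambda>b. f (\<lambda>i. if i \<in> {..k} then (if i = 0 then 1 else c i) else b i) -
        f (\<lambda>i. if i \<in> {..k} then 0 else b i))"
    have "g \<in> poly_funs ({..n} - {..k}) {..d - 1}"
      unfolding g_def by (rule poly_funs_partial_eval[OF f \<open>d \<ge> 1\<close>])
    also have "{..n} - {..k} = {k + 1..n}" by auto
    finally have g: "g \<in> poly_funs {k + 1..n} {..d - 1}" .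
    have gh: "g b = ?h (?m c b)" if b: "b \<in> Pi\<^sub>E {k + 1..n} K" for b
    proof -
      have "f (\<lambda>i. if i \<in> {..k} then 0 else b i) = f (\<lambda>i\<in>{..n}. if i \<in> {..k} then 0 else b i)"
        by (rule poly_funs_cong[OF f]) auto
      also have "\<dots> = 0"
        using b \<open>k \<le> n\<close> by (intro van) (auto simp: zero_in PiE_mem)
      finally have "g b = f (\<lambda>i. if i \<in> {..k} then (if i = 0 then 1 else c i) else b i)"
        by (simp add: g_def)
      also have "\<dots> = ?h (?m c b)"
        by (rule poly_funs_cong[OF f]) (auto simp: lead_embed_def)
      finally show ?thesis .
    qed
    have b0: "restrict x {k + 1..n} \<in> Pi\<^sub>E {k + 1..n} K"
      using x by (auto simp: lead_vectors_def PiE_def)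
    have "x i = c i" if "i \<in> {1..k}" for i
      using that v(2)[of i] \<open>v 0 \<noteq> 0\<close> \<open>k \<le> n\<close> by (simp add: x_def)
    then have "?h (?m c (restrict x {k + 1..n})) = f x"
      using x by (intro poly_funs_cong[OF f]) (auto simp: lead_embed_def lead_vectors_def)
    then have "g (restrict x {k + 1..n}) \<noteq> 0"
      using gh[OF b0] \<open>f x \<noteq> 0\<close> by simp
    then have "affine_dist {k + 1..n} (d - 1) \<le> card {b \<in> Pi\<^sub>E {k + 1..n} K. g b \<noteq> 0}"
      by (rule affine_dist_le[OF g b0])
    also have "{b \<in> Pi\<^sub>E {k + 1..n} K. g b \<noteq> 0} = {b \<in> Pi\<^sub>E {k + 1..n} K. ?h (?m c b) \<noteq> 0}"
      using gh by (intro Collect_cong conj_cong refl) simp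
    finally show ?thesis .
  qed
  have union: "{1..k} \<union> {k + 1..n} = {1..n}"
    using \<open>k \<le> n\<close> by auto
  have "affine_dist {1..n} (d - 1) \<le> card (Pi\<^sub>E {1..k} K) * affine_dist {k + 1..n} (d - 1)"
    using affine_dist_Un_le[of "{1..k}" "{k + 1..n}" "d - 1"] unfolding union by auto
  also have "\<dots> = (\<Sum>c\<in>Pi\<^sub>E {1..k} K. affine_dist {k + 1..n} (d - 1))"
    by (simp only: sum_constant of_nat_id)
  also have "\<dots> \<le> (\<Sum>c\<in>Pi\<^sub>E {1..k} K. card {b \<in> Pi\<^sub>E {k + 1..n} K. ?h (?m c b) \<noteq> 0})"
    by (rule sum_mono) (rule bound)
  also have "\<dots> = card {a \<in> Pi\<^sub>E {1..n} K. ?h a \<noteq> 0}"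
    using card_fibres[of "{1..k}" "{k + 1..n}" "\<lambda>a. ?h a \<noteq> 0"] unfolding union by simp
  finally show ?thesis
    using card_affine_chart_le[OF f] mult_le_mono2 order_trans by blast
qed

text \<open>On each line in direction \<open>z\<close>, \<open>f\<close> is a polynomial of degree
  at most \<open>d\<close> with nonzero coefficient \<open>f z\<close> at \<open>d\<close>, so it
  has at most \<open>d\<close> zeros. The pairs of a vector v and a scalar t with \<open>f\<close>
  nonzero at v + t z are counted in two ways: along lines, and for fixed t, where the translation
  maps \<open>V\<close> injectively into itself.\<close>

lemma card_lines_le:
  assumes f: "f \<in> poly_funs {..n} {d}"
    and z: "z \<in> Pi\<^sub>E {..n} K" "f z \<noteq> 0" "\<And>i. i < m \<Longrightarrow> z i = 0" "m \<le> n" "d < card (K m)"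
    and V: "V \<subseteq> Pi\<^sub>E {..n} K"
      "\<And>v t. v \<in> V \<Longrightarrow> t \<in> K m \<Longrightarrow> (\<lambda>i\<in>{..n}. v i + t * z i) \<in> V"
  shows "card V * (card (K m) - d) \<le> card (K m) * card {v \<in> V. f v \<noteq> 0}"
proof -
  let ?l = "\<lambda>v t. \<lambda>i\<in>{..n}. v i + t * z i"
  have fin: "finite V"
    using V(1) finite_PiE_K[of "{..n}"] by (meson finite_atMost finite_subset)
  have "card (K m) - d \<le> card {t \<in> K m. f (?l v t) \<noteq> 0}" if "v \<in> V" for v
  proof -
    obtain p where p: "degree p \<le> d" "coeff p d = f z" "\<And>t. poly p t = f (\<lambda>i. v i + t * z i)"
      using poly_funs_on_line[OF f] by blast
    have l: "f (?l v t) = poly p t" for t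
      unfolding p(3) by (rule poly_funs_cong[OF f]) simp
    have "p \<noteq> 0"
      using p(2) z(2) by auto
    then have "card {t. poly p t = 0} \<le> d"
      using card_poly_roots_bound[of p] p(1) by simp
    moreover have "card (K m) \<le> card {t \<in> K m. f (?l v t) \<noteq> 0} + card {t. poly p t = 0}"
      using card_mono[of "{t \<in> K m. f (?l v t) \<noteq> 0} \<union> {t. poly p t = 0}" "K m"]
      by (intro order_trans[OF _ card_Un_le]) (auto simp: l)
    ultimately show ?thesis by simp
  qed
  then have "card V * (card (K m) - d) \<le> (\<Sum>v\<in>V. card {t \<in> K m. f (?l v t) \<noteq> 0})"
    using sum_bounded_below[of V "card (K m) - d" "\<lambda>v. card {t \<in> K m. f (?l v t) \<noteq> 0}"] by simp
  also have "\<dots> = (\<Sum>t\<in>K m. card {v \<in> V. f (?l v t) \<noteq> 0})"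
    using fin by (intro sum_multicount_gen) auto
  also have "\<dots> \<le> (\<Sum>t\<in>K m. card {v \<in> V. f v \<noteq> 0})"
  proof (rule sum_mono)
    fix t assume t: "t \<in> K m"
    show "card {v \<in> V. f (?l v t) \<noteq> 0} \<le> card {v \<in> V. f v \<noteq> 0}"
    proof (rule card_inj_on_le[of "\<lambda>v. ?l v t"])
      show "inj_on (\<lambda>v. ?l v t) {v \<in> V. f (?l v t) \<noteq> 0}"
      proof (rule inj_onI)
        fix v w assume vw: "v \<in> {v \<in> V. f (?l v t) \<noteq> 0}" "w \<in> {v \<in> V. f (?l v t) \<noteq> 0}" "?l v t = ?l w t"
        have "v i = w i" if "i \<in> {..n}" for i
          using fun_cong[OF vw(3), of i] that by simp
        then show "v = w"
          using vw(1,2) V(1) by (intro PiE_ext[of v "{..n}" K w]) auto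
      qed
      show "(\<lambda>v. ?l v t) ` {v \<in> V. f (?l v t) \<noteq> 0} \<subseteq> {v \<in> V. f v \<noteq> 0}"
        using V(2) t by auto
      show "finite {v \<in> V. f v \<noteq> 0}"
        using fin by simp
    qed
  qed
  finally show ?thesis by simp
qed

text \<open>A polynomial of minimal weight is homogenized with x_0; the form vanishes where x_0 = 0,
  so all its nonzeros lie in the chart x_0 = 1. This gives the upper bound for the projective
  distance.\<close>

lemma ex_proj_word_of_affine_dist:
  assumes "d \<ge> 1"
  shows "\<exists>w\<in>proj_code n K d. w \<noteq> (\<lambda>_. 0) \<and> weight w = affine_dist {1..n} (d - 1)"
proof -
  obtain g a where g: "g \<in> poly_funs {1..n} {..d - 1}" "a \<in> Pi\<^sub>E {1..n} K" "g a \<noteq> 0"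
    "card {a \<in> Pi\<^sub>E {1..n} K. g a \<noteq> 0} = affine_dist {1..n} (d - 1)"
    using affine_dist_attained[of "{1..n}" "d - 1"] by auto
  obtain f where f: "f \<in> poly_funs {..n} {d}" "\<And>x. x 0 = 0 \<Longrightarrow> f x = 0" "\<And>x. x 0 = 1 \<Longrightarrow> f x = g x"
    using ex_homogenization[OF g(1) assms, of 0 "{..n}"] by auto
  have bij: "bij_betw (lead_embed 0) (Pi\<^sub>E {1..n} K) (lead_vectors 0)"
    using bij_betw_lead_embed[of 0] by simp
  have fg: "f (lead_embed 0 b) = g b" for b
  proof -
    have "f (lead_embed 0 b) = g (lead_embed 0 b)"
      by (rule f(3)) (simp add: lead_embed_def)
    also have "\<dots> = g b"
      by (rule poly_funs_cong[OF g(1)]) (simp add: lead_embed_def)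
    finally show ?thesis .
  qed
  have std: "{x \<in> std_vectors 0. f x \<noteq> 0} = {x \<in> lead_vectors 0. f x \<noteq> 0}"
    using f(2) by (auto simp: std_vectors_def lead_vectors_def)
  have "bij_betw (lead_embed 0) {a \<in> Pi\<^sub>E {1..n} K. g a \<noteq> 0} {x \<in> std_vectors 0. f x \<noteq> 0}"
  proof (rule bij_betw_subset[OF bij])
    show "lead_embed 0 ` {a \<in> Pi\<^sub>E {1..n} K. g a \<noteq> 0} = {x \<in> std_vectors 0. f x \<noteq> 0}"
      unfolding std bij_betw_imp_surj_on[OF bij, symmetric] by (auto simp: fg)
  qed auto
  then have "card {x \<in> std_vectors 0. f x \<noteq> 0} = affine_dist {1..n} (d - 1)"
    unfolding g(4)[symmetric] by (rule bij_betw_same_card[symmetric])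
  moreover have "lead_embed 0 a \<in> {x \<in> std_vectors 0. f x \<noteq> 0}"
    unfolding std using bij g(2,3) fg by (auto simp: bij_betw_def)
  ultimately show ?thesis
    using f(1) unfolding proj_code_eq
    by (intro bexI[OF _ imageI]) (auto simp: weight_proj_word proj_word_eq_0_iff)
qed

end

section \<open>Lower bounds when the fields K_0, ..., K_r coincide\<close>

locale constant_prefix = nested_subfields +
  fixes r :: nat
  assumes r_pos: "1 \<le> r" and r_le: "r \<le> n"
    and K_prefix: "i \<le> r \<Longrightarrow> K i = K 0"
begin

text \<open>The first nonzero entry of such a vector sits at an index at most \<open>r\<close> and
  hence lies in \<open>K 0\<close>. Thus at most \<open>card (K 0) - 1\<close> of these vectors
  normalize to the same standard representative.\<close>

lemma card_vectors_le:
  assumes f: "f \<in> poly_funs {..n} {d}"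
  shows "card {v \<in> Pi\<^sub>E {..n} K. (\<exists>i\<le>r. v i \<noteq> 0) \<and> f v \<noteq> 0} \<le>
    (card (K 0) - 1) * card {x \<in> std_vectors 0. f x \<noteq> 0}"
proof -
  define m where "m v = (LEAST i. v i \<noteq> 0)" for v :: "nat \<Rightarrow> 'a"
  let ?V = "{v \<in> Pi\<^sub>E {..n} K. (\<exists>i\<le>r. v i \<noteq> 0) \<and> f v \<noteq> 0}"
  let ?\<phi> = "\<lambda>v. (v (m v), \<lambda>i\<in>{..n}. inverse (v (m v)) * v i)"
  have m: "v (m v) \<noteq> 0" "m v \<le> r" "\<And>l. l < m v \<Longrightarrow> v l = 0" if v: "v \<in> ?V" for v
  proof -
    obtain i where i: "i \<le> r" "v i \<noteq> 0" using v by blast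
    show "v (m v) \<noteq> 0" unfolding m_def by (rule LeastI[of _ i]) (rule i)
    show "m v \<le> r" using Least_le[of "\<lambda>i. v i \<noteq> 0" i] i unfolding m_def by simp
    show "v l = 0" if "l < m v" for l
      using not_less_Least[of l "\<lambda>i. v i \<noteq> 0"] that unfolding m_def by simp
  qed
  have "card ?V \<le> card ((K 0 - {0}) \<times> {x \<in> std_vectors 0. f x \<noteq> 0})"
  proof (rule card_inj_on_le)
    show "inj_on ?\<phi> ?V"
    proof (rule inj_onI)
      fix v w assume vw: "v \<in> ?V" "w \<in> ?V" "?\<phi> v = ?\<phi> w"
      have "v i = w i" if "i \<in> {..n}" for i
      proof -
        have "inverse (v (m v)) * v i = inverse (w (m w)) * w i"
          using vw(3) that by (auto dest: fun_cong[of _ _ i])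
        then show ?thesis
          using vw(3) m(1)[OF vw(1)] by simp
      qed
      then show "v = w"
        using vw(1,2) by (intro PiE_ext[of v "{..n}" K w]) auto
    qed
    show "?\<phi> ` ?V \<subseteq> (K 0 - {0}) \<times> {x \<in> std_vectors 0. f x \<noteq> 0}"
    proof (rule image_subsetI)
      fix v assume v: "v \<in> ?V"
      have "f (\<lambda>i\<in>{..n}. inverse (v (m v)) * v i) = inverse (v (m v)) ^ d * f v"
        by (rule poly_funs_homogeneous[OF f]) simp
      then have "f (\<lambda>i\<in>{..n}. inverse (v (m v)) * v i) \<noteq> 0"
        using v m(1)[OF v] by simp
      moreover have "(\<lambda>i\<in>{..n}. inverse (v (m v)) * v i) \<in> lead_vectors (m v)"
        using v m[OF v] r_le by (intro normalize_in) auto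
      then have "(\<lambda>i\<in>{..n}. inverse (v (m v)) * v i) \<in> std_vectors 0"
        using m(2)[OF v] r_le by (auto simp: std_vectors_def)
      moreover have "v (m v) \<in> K 0"
        using v m(2)[OF v] r_le K_prefix[OF m(2)[OF v]] by (auto simp: PiE_def Pi_def)
      ultimately show "?\<phi> v \<in> (K 0 - {0}) \<times> {x \<in> std_vectors 0. f x \<noteq> 0}"
        using m(1)[OF v] by simp
    qed
    show "finite ((K 0 - {0}) \<times> {x \<in> std_vectors 0. f x \<noteq> 0})"
      using finite_std_vectors by simp
  qed
  then show ?thesis
    using zero_in[of 0] by (simp add: card_cartesian_product card_Diff_singleton)
qed

text \<open>Induction on \<open>k\<close> implements the choice of a minimal \<open>k\<close>. If
  every slice contains a nonzero, the slice bound applies; otherwise \<open>f\<close> vanishes on a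
  slice, and a linear change over \<open>K 0\<close> that permutes the product brings
  \<open>f\<close> into the situation of the induction hypothesis. For \<open>k = 0\<close> the only
  slice consists of all vectors.\<close>

lemma card_ge_affine_dist:
  assumes "f \<in> poly_funs {..n} {d}" "d \<ge> 1" "k \<le> r"
    and "\<And>v. v \<in> Pi\<^sub>E {..n} K \<Longrightarrow> (\<And>i. i \<le> k \<Longrightarrow> v i = 0) \<Longrightarrow> f v = 0"
    and "\<exists>v\<in>Pi\<^sub>E {..n} K. f v \<noteq> 0"
  shows "(card (K 0) - 1) * affine_dist {1..n} (d - 1) \<le> card {v \<in> Pi\<^sub>E {..n} K. f v \<noteq> 0}"
  using assms(1,3,4,5)
proof (induction k arbitrary: f)
  case 0
  then show ?case
    using \<open>d \<ge> 1\<close> by (intro card_ge_affine_dist_of_slices[where k = 0]) auto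
next
  case (Suc k)
  let ?C = "Pi\<^sub>E {..n} K"
  note f = Suc.prems(1) and van = Suc.prems(3)
  have kn: "Suc k \<le> n" using Suc.prems(2) r_le by simp
  show ?case
  proof (cases "\<forall>c\<in>Pi\<^sub>E {1..Suc k} K. \<exists>v\<in>?C. (\<forall>i\<in>{1..Suc k}. v i = c i * v 0) \<and> f v \<noteq> 0")
    case True
    then show ?thesis
      using f \<open>d \<ge> 1\<close> kn van by (intro card_ge_affine_dist_of_slices[where k = "Suc k"]) blast+
  next
    case False
    then obtain c where c: "c \<in> Pi\<^sub>E {1..Suc k} K"
      and "\<not> (\<exists>v\<in>?C. (\<forall>i\<in>{1..Suc k}. v i = c i * v 0) \<and> f v \<noteq> 0)"
      by blast
    then have van_c: "f v = 0" if "v \<in> ?C" "\<forall>i\<in>{1..Suc k}. v i = c i * v 0" for v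
      using that by blast
    \<comment> \<open>\<open>T\<close> maps \<open>y\<^sub>0 = \<dots> = y\<^sub>k = 0\<close> onto the slice on which \<open>f\<close> vanishes.\<close>
    define T where "T y = (\<lambda>i\<in>{..n}. if i = 0 then y (Suc k)
      else if i \<le> Suc k then y (i - 1) + c i * y (Suc k) else y i)" for y :: "nat \<Rightarrow> 'a"
    have Kk: "K i = K 0" if "i \<le> Suc k" for i
      using that Suc.prems(2) by (intro K_prefix) simp
    \<comment> \<open>Equality of the fields with indices 0 to \<open>Suc k\<close> is essential
      here, since \<open>T\<close> mixes exactly these coordinates.\<close>
    have T_in: "T y \<in> ?C" if y: "y \<in> ?C" for y
    proof -
      have y0: "y i \<in> K 0" if "i \<le> Suc k" for i
        using PiE_mem[OF y, of i] that kn unfolding Kk[OF that, symmetric] by simp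
      have "y (i - 1) + c i * y (Suc k) \<in> K 0" if "i \<in> {1..Suc k}" for i
      proof -
        have "i \<le> Suc k" "i - 1 \<le> Suc k" using that by auto
        then have "c i \<in> K 0" "y (i - 1) \<in> K 0" "y (Suc k) \<in> K 0"
          using PiE_mem[OF c that] Kk[of i] y0 by blast+
        then show ?thesis by (intro add_in mult_in) simp_all
      qed
      then have "T y i \<in> K i" if "i \<le> n" for i
        using that y0[of "Suc k"] Kk[of i] Kk[of 0] PiE_mem[OF y, of i]
        by (cases "i = 0"; cases "i \<le> Suc k") (simp_all add: T_def)
      then show ?thesis by (auto simp: T_def)
    qed
    have T_inj: "inj_on T ?C"
    proof (rule inj_onI)
      fix y y' assume yy: "y \<in> ?C" "y' \<in> ?C" "T y = T y'"
      have eq: "T y i = T y' i" for i using yy(3) by simp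
      have last: "y (Suc k) = y' (Suc k)"
        using eq[of 0] by (simp add: T_def)
      have "y i = y' i" if "i \<in> {..n}" for i
      proof (cases "i \<le> k")
        case True
        then show ?thesis using eq[of "Suc i"] kn last by (simp add: T_def)
      next
        case False
        then show ?thesis using eq[of i] that last by (cases "i = Suc k") (auto simp: T_def)
      qed
      then show "y = y'"
        using yy(1,2) by (intro PiE_ext[of y "{..n}" K y']) auto
    qed
    have fin: "finite ?C" using finite_PiE_K by simp
    \<comment> \<open>Surjectivity carries a nonzero of \<open>f\<close> back to one of its
      composition with \<open>T\<close>, as the induction hypothesis demands.\<close>
    have T_surj: "T ` ?C = ?C"
      using T_in T_inj fin by (intro endo_inj_surj) auto
    have "(\<lambda>y. f (T y)) \<in> poly_funs {..n} {d}"
    proof (rule poly_funs_subst[OF f])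
      fix i assume "i \<in> {..n}"
      then show "(\<lambda>y. T y i) \<in> poly_funs {..n} {1}"
        using kn unfolding T_def
        by (cases "i = 0"; cases "i \<le> Suc k") (auto intro!: poly_funs_add poly_funs_scale poly_funs_var)
    qed
    moreover have "f (T v) = 0" if v: "v \<in> ?C" "\<And>i. i \<le> k \<Longrightarrow> v i = 0" for v
      using v(2) kn by (intro van_c T_in v(1)) (auto simp: T_def)
    moreover have "\<exists>v\<in>?C. f (T v) \<noteq> 0"
    proof -
      have "\<exists>v\<in>T ` ?C. f v \<noteq> 0"
        using Suc.prems(4) unfolding T_surj .
      then show ?thesis by blast
    qed
    ultimately have "(card (K 0) - 1) * affine_dist {1..n} (d - 1) \<le> card {v \<in> ?C. f (T v) \<noteq> 0}"
      using Suc.prems(2) by (intro Suc.IH) auto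
    also have "\<dots> \<le> card {v \<in> ?C. f v \<noteq> 0}"
      using T_in T_inj fin by (intro card_inj_on_le[of T]) (auto intro: inj_on_subset)
    finally show ?thesis .
  qed
qed

text \<open>This is \<open>affine_dist_le_prod\<close> with \<open>u\<close> linear factors in x_1
  and \<open>v\<close> in x_(r+1). The variables x_2, ..., x_r contribute the power
  \<open>card (K 0) ^ (r - 1)\<close>.\<close>

lemma affine_dist_le_two_factors:
  assumes "r < n" "u < card (K 0)" "v < card (K (r + 1))" "u + v \<le> e"
  shows "affine_dist {1..n} e \<le>
    (card (K 0) - u) * (card (K (r + 1)) - v) * (card (K 0) ^ (r - 1) * (\<Prod>i\<in>{r + 2..n}. card (K i)))"
proof -
  define w where "w i = (if i = 1 then u else if i = r + 1 then v else 0)" for i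
  have K1: "K 1 = K 0" using K_prefix r_pos by blast
  let ?I = "{2..r} \<union> {r + 2..n}"
  have split: "{1..n} = insert 1 (insert (r + 1) ?I)"
    using assms(1) r_pos by auto
  have 1: "1 \<notin> insert (r + 1) ?I" "r + 1 \<notin> ?I" "finite ?I" and disj: "{2..r} \<inter> {r + 2..n} = {}"
    using r_pos by auto
  have sum: "(\<Sum>i\<in>{1..n}. w i) = u + v"
  proof -
    have "(\<Sum>i\<in>?I. w i) = 0"
      by (intro sum.neutral) (auto simp: w_def)
    then show ?thesis
      unfolding split using 1 r_pos by (simp add: w_def)
  qed
  have "affine_dist {1..n} e \<le> (\<Prod>i\<in>{1..n}. card (K i) - w i)"
    using assms K1 card_pos sum by (intro affine_dist_le_prod) (auto simp: w_def)
  also have "\<dots> = (card (K 1) - w 1) * ((card (K (r + 1)) - w (r + 1)) * (\<Prod>i\<in>?I. card (K i) - w i))"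
    unfolding split using 1 by simp
  also have "(\<Prod>i\<in>?I. card (K i) - w i) = (\<Prod>i\<in>?I. card (K i))"
    by (intro prod.cong) (auto simp: w_def)
  also have "\<dots> = (\<Prod>i\<in>{2..r}. card (K i)) * (\<Prod>i\<in>{r + 2..n}. card (K i))"
    using disj by (intro prod.union_disjoint) auto
  also have "(\<Prod>i\<in>{2..r}. card (K i)) = (\<Prod>i\<in>{2..r}. card (K 0))"
    by (intro prod.cong refl arg_cong[where f = card] K_prefix) simp
  also have "\<dots> = card (K 0) ^ (r - 1)"
    by simp
  finally show ?thesis
    using K1 r_pos by (simp add: w_def mult_ac)
qed

text \<open>The factor \<open>card (K 0) - 1\<close> converts points into vectors for both cases of
  the argument and is cancelled at the end.\<close>

lemma card_std_ge_affine_dist: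
  assumes f: "f \<in> poly_funs {..n} {d}" and "d \<ge> 1"
    and nz: "\<exists>x\<in>std_vectors 0. f x \<noteq> 0"
    and jump: "r < n \<Longrightarrow> K (r + 1) \<noteq> K r \<and> d < card (K (r + 1))"
  shows "affine_dist {1..n} (d - 1) \<le> card {x \<in> std_vectors 0. f x \<noteq> 0}"
proof -
  let ?C = "Pi\<^sub>E {..n} K" and ?N = "card {x \<in> std_vectors 0. f x \<noteq> 0}"
  let ?V = "{v \<in> ?C. \<exists>i\<le>r. v i \<noteq> 0}"
  let ?q = "card (K 0)"
  have q: "?q \<ge> 2" by (rule card_ge_2) simp
  have N: "card {v \<in> ?V. f v \<noteq> 0} \<le> (?q - 1) * ?N"
    using card_vectors_le[OF f] by (simp add: conj_assoc)
  have "(?q - 1) * affine_dist {1..n} (d - 1) \<le> (?q - 1) * ?N"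
  proof (cases "\<forall>v\<in>?C. (\<forall>i\<le>r. v i = 0) \<longrightarrow> f v = 0")
    case True
    have "\<exists>v\<in>?C. f v \<noteq> 0"
      using nz by (auto simp: std_vectors_def lead_vectors_def)
    then have "(?q - 1) * affine_dist {1..n} (d - 1) \<le> card {v \<in> ?C. f v \<noteq> 0}"
      using f \<open>d \<ge> 1\<close> True by (intro card_ge_affine_dist[where k = r]) auto
    also have "{v \<in> ?C. f v \<noteq> 0} = {v \<in> ?V. f v \<noteq> 0}"
      using True by auto
    finally show ?thesis using N by (rule order_trans)
  next
    case False
    then obtain z where z: "z \<in> ?C" "\<And>i. i \<le> r \<Longrightarrow> z i = 0" "f z \<noteq> 0"
      by blast
    have "r < n"
    proof (rule ccontr)
      assume "\<not> r < n"
      \<comment> \<open>If \<open>r = n\<close>, all entries of \<open>z\<close> are 0, so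
        homogeneity applies with the scalar 0.\<close>
      then have "f z = 0 ^ d * f z"
        using z(2) r_le by (intro poly_funs_homogeneous[OF f]) auto
      then show False using z(3) \<open>d \<ge> 1\<close> by (simp add: power_0_left)
    qed
    let ?D = "card (K (r + 1))"
    let ?R = "\<Prod>i\<in>{r + 2..n}. card (K i)"
    have D: "2 * ?q \<le> ?D" "d < ?D"
      using card_twice_le[of r "r + 1"] jump \<open>r < n\<close> K_prefix[of r] by auto
    \<comment> \<open>The direction \<open>z\<close> is 0 in the coordinates up to \<open>r\<close>,
      so translation along it preserves \<open>?V\<close>; only vectors of \<open>?V\<close> are
      controlled by \<open>card_vectors_le\<close>.\<close>
    have "card ?V * (?D - d) \<le> ?D * card {v \<in> ?V. f v \<noteq> 0}"
    proof (rule card_lines_le[OF f z(1,3)])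
      show "z i = 0" if "i < r + 1" for i using that z(2) by simp
      show "r + 1 \<le> n" "d < ?D" using \<open>r < n\<close> D by auto
      show "?V \<subseteq> ?C" by auto
      fix v t assume v: "v \<in> ?V" and t: "t \<in> K (r + 1)"
      have "v i + t * z i \<in> K i" if "i \<le> n" for i
      proof (cases "i \<le> r")
        case True
        then show ?thesis using v that z(2) by (auto simp: PiE_mem)
      next
        case False
        then have "t \<in> K i" using subset_le[of "r + 1" i] that t by auto
        then show ?thesis
          using v z(1) that by (auto simp: PiE_mem intro!: add_in mult_in)
      qed
      then show "(\<lambda>i\<in>{..n}. v i + t * z i) \<in> ?V"
        using v z(2) r_le by auto
    qed
    \<comment> \<open>The factor \<open>?q ^ (r + 1) - 1\<close> counts the nonzero initial
      segments; the remaining coordinates are free.\<close>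
    moreover have "card ?V = (?q ^ (r + 1) - 1) * (?D * ?R)"
    proof -
      have union: "{..r} \<union> {r + 1..n} = {..n}" using r_le by auto
      have "card ?V = (\<Sum>c\<in>Pi\<^sub>E {..r} K. card {b \<in> Pi\<^sub>E {r + 1..n} K.
          \<exists>i\<le>r. (if i \<in> {..r} then c i else b i) \<noteq> 0})"
        by (subst union[symmetric], subst card_fibres) auto
      also have "\<dots> = (\<Sum>c\<in>Pi\<^sub>E {..r} K. if c = (\<lambda>i\<in>{..r}. 0) then 0 else card (Pi\<^sub>E {r + 1..n} K))"
      proof (intro sum.cong refl)
        fix c assume c: "c \<in> Pi\<^sub>E {..r} K"
        have "(\<exists>i\<le>r. (if i \<in> {..r} then c i else b i) \<noteq> 0) \<longleftrightarrow> c \<noteq> (\<lambda>i\<in>{..r}. 0)" for b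
          using c by (auto simp: fun_eq_iff PiE_def extensional_def)
        then show "card {b \<in> Pi\<^sub>E {r + 1..n} K. \<exists>i\<le>r. (if i \<in> {..r} then c i else b i) \<noteq> 0} =
            (if c = (\<lambda>i\<in>{..r}. 0) then 0 else card (Pi\<^sub>E {r + 1..n} K))"
          by (simp only:) simp
      qed
      also have "\<dots> = (\<Sum>c\<in>Pi\<^sub>E {..r} K - {\<lambda>i\<in>{..r}. 0}. card (Pi\<^sub>E {r + 1..n} K))"
        using finite_PiE_K by (intro sum.mono_neutral_cong_right) auto
      also have "\<dots> = (card (Pi\<^sub>E {..r} K) - 1) * card (Pi\<^sub>E {r + 1..n} K)"
        using zero_vector_in[of "{..r}"] r_le by (simp add: card_Diff_singleton)
      also have "card (Pi\<^sub>E {..r} K) = ?q ^ (r + 1)"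
      proof -
        have "card (Pi\<^sub>E {..r} K) = (\<Prod>i\<in>{..r}. card (K i))"
          by (simp add: card_PiE)
        also have "\<dots> = (\<Prod>i\<in>{..r}. ?q)"
          by (intro prod.cong refl arg_cong[where f = card] K_prefix) simp
        finally show ?thesis by simp
      qed
      also have "card (Pi\<^sub>E {r + 1..n} K) = ?D * ?R"
        using \<open>r < n\<close> by (simp add: card_PiE prod.atLeast_Suc_atMost)
      finally show ?thesis .
    qed
    ultimately have "?D * ((?q ^ (r + 1) - 1) * ?R * (?D - d)) \<le> ?D * card {v \<in> ?V. f v \<noteq> 0}"
      by (simp add: mult_ac)
    then have lower: "(?q ^ (r + 1) - 1) * ?R * (?D - d) \<le> (?q - 1) * ?N"
      using D(2) N by simp
    \<comment> \<open>If \<open>?D - d\<close> is at least \<open>?q\<close>, all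
      \<open>d - 1\<close> linear factors are spent on x_(r+1). Otherwise \<open>?q - 1\<close> of
      them go to x_1; then \<open>d\<close> exceeds \<open>?q\<close> because
      \<open>2 * ?q \<le> ?D\<close>, so the natural number \<open>d - ?q\<close> is a genuine
      difference.\<close>
    obtain u v where uv: "u < ?q" "v < ?D" "u + v \<le> d - 1" "(?q - u) * (?D - v) \<le> (?q + 1) * (?D - d)"
    proof (cases "?q \<le> ?D - d")
      case True
      have "?q * (?D - (d - 1)) = ?q * (?D - d) + ?q"
        using \<open>d \<ge> 1\<close> D(2) by (simp add: Suc_diff_le)
      then show ?thesis
        using True q D(2) by (intro that[of 0 "d - 1"]) auto
    next
      case False
      have "?q - (?q - 1) = 1" "?D - (d - ?q) = (?D - d) + ?q"
        using False D q by simp_all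
      then have "(?q - (?q - 1)) * (?D - (d - ?q)) = ?q * 1 + (?D - d)"
        by simp
      also have "\<dots> \<le> ?q * (?D - d) + (?D - d)"
        using D(2) by (intro add_right_mono mult_le_mono2) simp
      also have "\<dots> = (?q + 1) * (?D - d)"
        by simp
      finally show ?thesis
        using False q D by (intro that[of "?q - 1" "d - ?q"]) simp_all
    qed
    \<comment> \<open>With q = \<open>?q\<close>, the left side equals q^(r+1) - q^(r-1).\<close>
    have geometric: "(?q - 1) * (?q + 1) * ?q ^ (r - 1) \<le> ?q ^ (r + 1) - 1"
    proof -
      obtain s where s: "r = Suc s" using r_pos by (cases r) auto
      have "(?q - 1) * (?q + 1) = ?q ^ 2 - 1"
        by (simp add: algebra_simps power2_eq_square)
      then have "(?q - 1) * (?q + 1) * ?q ^ (r - 1) = ?q ^ (r + 1) - ?q ^ s"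
        by (simp add: s diff_mult_distrib power2_eq_square)
      moreover have "?q ^ s \<ge> 1" using q by simp
      ultimately show ?thesis by simp
    qed
    have "(?q - 1) * affine_dist {1..n} (d - 1) \<le>
        (?q - 1) * ((?q - u) * (?D - v) * (?q ^ (r - 1) * ?R))"
      using affine_dist_le_two_factors[OF \<open>r < n\<close> uv(1-3)] by (intro mult_le_mono2) simp
    also have "\<dots> \<le> (?q - 1) * ((?q + 1) * (?D - d) * (?q ^ (r - 1) * ?R))"
      using uv(4) by (intro mult_le_mono2 mult_le_mono1)
    also have "\<dots> = ((?q - 1) * (?q + 1) * ?q ^ (r - 1)) * ?R * (?D - d)"
      by (simp only: mult_ac)
    also have "\<dots> \<le> (?q ^ (r + 1) - 1) * ?R * (?D - d)"
      by (intro mult_le_mono1 geometric)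
    also note lower
    finally show ?thesis .
  qed
  then show ?thesis using q by simp
qed

end

theorem corollary3p10:
  fixes K :: "nat \<Rightarrow> 'k::{field, finite} set" and n d :: nat
  assumes "n \<ge> 1"
    and "\<And>i. i \<le> n \<Longrightarrow> is_subfield (K i)"
    and "\<And>i. i < n \<Longrightarrow> K i \<subseteq> K (Suc i)"
    and "d \<ge> 1"
    and "\<And>r. 1 \<le> r \<Longrightarrow> r + 1 \<le> n \<Longrightarrow> (\<forall>i\<in>{1..r}. card (K i) = card (K 1)) \<Longrightarrow>
           card (K r) < card (K (r + 1)) \<Longrightarrow> d < card (K (r + 1))"
  shows "card (proj_product n K) = (\<Sum>i=0..n. card (tail_product n K i)) \<and>
         code_dim (proj_code n K d) = (\<Sum>i=0..n. code_dim (tail_code n K i (d - 1))) \<and>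
         min_distance (proj_code n K d) = min_distance (tail_code n K n (d - 1))"
proof (intro conjI)
  interpret nested_subfields K n
    using assms(2,3) by unfold_locales
  show "card (proj_product n K) = (\<Sum>i=0..n. card (tail_product n K i))"
    by (rule card_proj_product)
  show "code_dim (proj_code n K d) = (\<Sum>i=0..n. code_dim (tail_code n K i (d - 1)))"
    by (rule code_dim_proj_code[OF assms(4)])
  \<comment> \<open>\<open>r\<close> will be the length of the longest initial run of equal fields
    K_1 = ... = K_r; it is \<open>n\<close> when all of them agree.\<close>
  define R where "R = {r \<in> {1..n}. \<forall>i\<in>{1..r}. K i = K 1}"
  define r where "r = Max R"
  have "finite R"
    unfolding R_def by simp
  moreover have "1 \<in> R"
    unfolding R_def using assms(1) by simp
  ultimately have "r \<in> R"
    unfolding r_def by (intro Max_in) auto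
  then have r_bounds: "1 \<le> r" "r \<le> n" and r_const: "\<And>i. i \<in> {1..r} \<Longrightarrow> K i = K 1"
    unfolding R_def by (simp, simp, blast)
  have jump: "K (r + 1) \<noteq> K r \<and> d < card (K (r + 1))" if "r < n"
  proof -
    have "K (r + 1) \<noteq> K r"
    proof
      assume eq: "K (r + 1) = K r"
      have "K i = K 1" if "i \<in> {1..r + 1}" for i
      proof (cases "i = r + 1")
        case True
        then show ?thesis using eq r_const[of r] r_bounds(1) by simp
      next
        case False
        then show ?thesis using r_const[of i] that by simp
      qed
      then have "r + 1 \<in> R"
        unfolding R_def using \<open>r < n\<close> by (intro CollectI conjI ballI) (simp, blast)
      then have "r + 1 \<le> r"
        unfolding r_def by (rule Max_ge[OF \<open>finite R\<close>])
      then show False by simp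
    qed
    \<comment> \<open>Maximality of \<open>r\<close> makes the inclusion of K_r in K_(r+1) strict.
      The cardinalities therefore jump, and the restriction on \<open>d\<close> becomes
      available.\<close>
    moreover from this have less: "card (K r) < card (K (r + 1))"
      using subset_le[of r "r + 1"] that by (intro psubset_card_mono) auto
    have const: "\<forall>i\<in>{1..r}. card (K i) = card (K 1)"
      by (intro ballI arg_cong[where f = card] r_const)
    have "d < card (K (r + 1))"
      by (rule assms(5)[OF r_bounds(1) _ const less]) (use that in simp)
    ultimately show ?thesis by blast
  qed
  \<comment> \<open>Replacing K_0 by K_1 extends the constant run to the index 0. A standard
    representative has first entry 0 or 1, so both families have the same
    \<open>std_vectors 0\<close>, and the affine code on \<open>{1..n}\<close> is unchanged.\<close>
  interpret L: constant_prefix "K(0 := K 1)" n r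
  proof unfold_locales
    show "is_subfield ((K(0 := K 1)) i)" if "i \<le> n" for i
      using that assms(1,2) by simp
    show "(K(0 := K 1)) i \<subseteq> (K(0 := K 1)) (Suc i)" if "i < n" for i
      using that assms(3) by simp
    show "(K(0 := K 1)) i = (K(0 := K 1)) 0" if "i \<le> r" for i
      using r_const[of i] that by (cases "i = 0") simp_all
  qed (use r_bounds in simp_all)
  have lead: "L.lead_vectors j = lead_vectors j" if "j \<le> n" for j
  proof -
    have "x 0 \<in> K 0 \<and> x 0 \<in> K 1" if "x j = 1 \<and> (\<forall>l<j. x l = 0)" for x :: "nat \<Rightarrow> 'k"
      using that zero_in[of 0] one_in[of 0] subset_le[of 0 1] assms(1) by (cases j) auto
    then show ?thesis
      unfolding lead_vectors_def L.lead_vectors_def by (auto simp: PiE_def Pi_def split: if_splits)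
  qed
  then have std: "L.std_vectors 0 = std_vectors 0"
    unfolding std_vectors_def L.std_vectors_def by simp
  have "Pi\<^sub>E {1..n} (K(0 := K 1)) = Pi\<^sub>E {1..n} K"
    by (intro PiE_cong) simp
  then have aff: "affine_code {1..n} (K(0 := K 1)) (d - 1) = affine_code {1..n} K (d - 1)"
    by (simp add: affine_code_def)
  \<comment> \<open>The word \<open>w\<close> gives the upper bound; a word \<open>v\<close> of
    minimal weight is then subjected to the lower bound.\<close>
  obtain w where w: "w \<in> proj_code n K d" "w \<noteq> (\<lambda>_. 0)" "weight w = affine_dist {1..n} (d - 1)"
    using ex_proj_word_of_affine_dist[OF assms(4)] by blast
  obtain v where v: "v \<in> proj_code n K d" "v \<noteq> (\<lambda>_. 0)" "weight v = min_distance (proj_code n K d)"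
    using min_distance_attained[OF w(1,2)] .
  obtain f where f: "f \<in> poly_funs {..n} {d}" "v = restr (proj_product n K) (\<lambda>P. f (std_rep n P))"
    using v(1) unfolding proj_code_eq by blast
  have "affine_dist {1..n} (d - 1) \<le> card {x \<in> std_vectors 0. f x \<noteq> 0}"
    using L.card_std_ge_affine_dist[OF f(1) assms(4)] jump v(2) r_bounds
    unfolding std aff f(2) proj_word_eq_0_iff by auto
  also have "\<dots> = min_distance (proj_code n K d)"
    using v(3) unfolding f(2) weight_proj_word .
  finally have "min_distance (proj_code n K d) = affine_dist {1..n} (d - 1)"
    using min_distance_le[OF w(1,2)] w(3) by simp
  then show "min_distance (proj_code n K d) = min_distance (tail_code n K n (d - 1))"
    using tail_code_eq[of 0 "d - 1"] by simp
qed

end
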